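(* Let $p$ be a prime number and let $K/\mathbb{Q}_p$ be a finite extension with ramification index $e$ and residue class degree $f$. Assume that $p>2+e$. Then $$B_{\rm m}(2,K)=3(p^f-1).$$
   Context: For a field $K$, $B_{\rm m}(2,K)$ denotes the supremum of the number of roots in $K^\ast=K\setminus\{0\}$, counted with multiplicities, that a non-zero polynomial in $K[x]$ with at most $3$ monomial terms can have. *)

theory Defs
  imports
    "Berlekamp_Zassenhaus.Finite_Field"
    "HOL-Algebra.Embedded_Algebras"
    "HOL-Algebra.QuotRing"
    "HOL-Library.Extended_Nat"
begin

section \<open>The \<open>p\<close>-adic absolute value on the rationals\<close>

definition rat_padic_val :: "nat \<Rightarrow> rat \<Rightarrow> int" where
  "rat_padic_val p x =
     int (multiplicity (int p) (fst (quotient_of x))) -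
     int (multiplicity (int p) (snd (quotient_of x)))"

definition rat_padic_abs :: "nat \<Rightarrow> rat \<Rightarrow> real" where
  "rat_padic_abs p x = (if x = 0 then 0 else real p powi (- rat_padic_val p x))"

definition padic_cauchy :: "nat \<Rightarrow> (nat \<Rightarrow> rat) \<Rightarrow> bool" where
  "padic_cauchy p X \<longleftrightarrow>
     (\<forall>\<epsilon>>0. \<exists>N. \<forall>m\<ge>N. \<forall>n\<ge>N. rat_padic_abs p (X m - X n) < \<epsilon>)"

definition padic_null :: "nat \<Rightarrow> (nat \<Rightarrow> rat) \<Rightarrow> bool" where
  "padic_null p X \<longleftrightarrow> (\<lambda>n. rat_padic_abs p (X n)) \<longlonglongrightarrow> 0"

lemma rat_padic_val_frac:
  assumes p: "prime p" and "a \<noteq> 0" "b \<noteq> 0"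
  shows "rat_padic_val p (of_int a / of_int b) =
           int (multiplicity (int p) a) - int (multiplicity (int p) b)"
proof -
  define q :: rat where "q = of_int a / of_int b"
  obtain n d where nd: "quotient_of q = (n, d)" by fastforce
  have d: "d > 0" and q: "q = of_int n / of_int d"
    using quotient_of_denom_pos[OF nd] quotient_of_div[OF nd] by auto
  have "q \<noteq> 0" using assms by (simp add: q_def)
  hence n: "n \<noteq> 0" using q by auto
  have "(of_int a :: rat) * of_int d = of_int n * of_int b"
    using q assms d unfolding q_def by (simp add: field_simps)
  hence e: "a * d = n * b" by (metis of_int_eq_iff of_int_mult)
  have pe: "prime_elem (int p)" using p by auto
  have "multiplicity (int p) a + multiplicity (int p) d =
        multiplicity (int p) n + multiplicity (int p) b"
    using arg_cong[OF e, of "multiplicity (int p)"] assms d n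
    by (simp add: prime_elem_multiplicity_mult_distrib[OF pe])
  thus ?thesis unfolding rat_padic_val_def q_def[symmetric] nd by simp
qed

context
  fixes p :: nat
  assumes p: "prime p"
begin

lemma rat_padic_abs_0 [simp]: "rat_padic_abs p 0 = 0"
  by (simp add: rat_padic_abs_def)

lemma rat_padic_abs_pos: "x \<noteq> 0 \<Longrightarrow> rat_padic_abs p x > 0"
  using p prime_gt_0_nat by (simp add: rat_padic_abs_def)

lemma rat_padic_abs_nonneg: "rat_padic_abs p x \<ge> 0"
  using rat_padic_abs_pos[of x] by (cases "x = 0") auto

lemma rat_padic_abs_eq_0: "rat_padic_abs p x = 0 \<longleftrightarrow> x = 0"
  using rat_padic_abs_pos[of x] by (cases "x = 0") auto

lemma rat_fracs:
  fixes x y :: rat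
  obtains a b c where "x = of_int a / of_int c" "y = of_int b / of_int c" "c \<noteq> 0"
proof -
  obtain n d where nd: "quotient_of x = (n, d)" by fastforce
  obtain n' d' where nd': "quotient_of y = (n', d')" by fastforce
  show ?thesis
    using quotient_of_denom_pos[OF nd] quotient_of_div[OF nd]
      quotient_of_denom_pos[OF nd'] quotient_of_div[OF nd']
    by (intro that[of "n * d'" "d * d'" "n' * d"]) (auto simp: field_simps)
qed

lemma rat_padic_abs_mult:
  "rat_padic_abs p (x * y) = rat_padic_abs p x * rat_padic_abs p y"
proof (cases "x = 0 \<or> y = 0")
  case False
  obtain a b c where abc: "x = of_int a / of_int c" "y = of_int b / of_int c" "c \<noteq> 0"
    by (rule rat_fracs)
  have nz: "a \<noteq> 0" "b \<noteq> 0" using False abc by auto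
  have xy: "x * y = of_int (a * b) / of_int (c * c)" using abc by simp
  have pe: "prime_elem (int p)" using p by auto
  have "rat_padic_val p (x * y) = rat_padic_val p x + rat_padic_val p y"
    unfolding xy unfolding abc(1,2)
    using nz abc(3)
    by (simp only: rat_padic_val_frac[OF p] mult_eq_0_iff simp_thms
        prime_elem_multiplicity_mult_distrib[OF pe])
  moreover have "real p \<noteq> 0" using p by auto
  ultimately show ?thesis using False
    by (simp add: rat_padic_abs_def power_int_add[symmetric])
qed auto

lemma rat_padic_abs_1 [simp]: "rat_padic_abs p 1 = 1"
  using rat_padic_abs_mult[of 1 1] rat_padic_abs_pos[of 1] by simp

lemma rat_padic_abs_minus [simp]: "rat_padic_abs p (- x) = rat_padic_abs p x"
proof -
  have "rat_padic_abs p (-1) ^ 2 = 1"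
    using rat_padic_abs_mult[of "-1" "-1"] by (simp add: power2_eq_square)
  hence "rat_padic_abs p (-1) = 1"
    using rat_padic_abs_nonneg[of "-1"] by (simp add: power2_eq_1_iff)
  thus ?thesis using rat_padic_abs_mult[of "-1" x] by simp
qed

lemma rat_padic_abs_add:
  "rat_padic_abs p (x + y) \<le> max (rat_padic_abs p x) (rat_padic_abs p y)"
proof (cases "x = 0 \<or> y = 0 \<or> x + y = 0")
  case True
  thus ?thesis using rat_padic_abs_nonneg[of x] by (auto simp: le_max_iff_disj)
next
  case False
  obtain a b c where abc: "x = of_int a / of_int c" "y = of_int b / of_int c" "c \<noteq> 0"
    by (rule rat_fracs)
  have nz: "a \<noteq> 0" "b \<noteq> 0" using False abc by auto
  have xy: "x + y = of_int (a + b) / of_int c" using abc by (simp add: add_divide_distrib)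
  have nz': "a + b \<noteq> 0" using False xy by auto
  have nu: "\<not> is_unit (int p)" using p not_prime_unit by auto
  define k where "k = min (multiplicity (int p) a) (multiplicity (int p) b)"
  have "int p ^ k dvd a + b"
    unfolding k_def by (intro dvd_add multiplicity_dvd') auto
  hence "k \<le> multiplicity (int p) (a + b)"
    using nz' nu by (intro multiplicity_geI) auto
  hence "rat_padic_val p (x + y) \<ge> min (rat_padic_val p x) (rat_padic_val p y)"
    unfolding xy unfolding abc(1,2)
      rat_padic_val_frac[OF p nz(1) abc(3)] rat_padic_val_frac[OF p nz(2) abc(3)]
      rat_padic_val_frac[OF p nz' abc(3)]
    by (auto simp: k_def)
  moreover have "real p \<ge> 1" using prime_ge_1_nat[OF p] by simp
  ultimately show ?thesis using False
    by (auto simp: rat_padic_abs_def le_max_iff_disj min_le_iff_disj intro: power_int_increasing)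
qed

lemma rat_padic_abs_add_le: "rat_padic_abs p (x + y) \<le> rat_padic_abs p x + rat_padic_abs p y"
  using rat_padic_abs_add[of x y] rat_padic_abs_nonneg[of x] rat_padic_abs_nonneg[of y] by linarith

lemma rat_padic_abs_diff_le: "rat_padic_abs p (x - y) \<le> rat_padic_abs p x + rat_padic_abs p y"
  using rat_padic_abs_add_le[of x "- y"] by simp

lemma rat_padic_abs_diff3: "rat_padic_abs p x - rat_padic_abs p y \<le> rat_padic_abs p (x - y)"
  using rat_padic_abs_add_le[of "x - y" y] by simp

lemma padic_cauchy_bounded:
  assumes "padic_cauchy p X"
  obtains B where "B > 0" "\<And>n. rat_padic_abs p (X n) \<le> B"
proof -
  obtain N where N: "\<And>m n. m \<ge> N \<Longrightarrow> n \<ge> N \<Longrightarrow> rat_padic_abs p (X m - X n) < 1"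
    using assms unfolding padic_cauchy_def by (meson zero_less_one)
  define B where "B = Max ((\<lambda>n. rat_padic_abs p (X n)) ` {..N}) + 1"
  have le: "rat_padic_abs p (X n) + 1 \<le> B" if "n \<le> N" for n
    unfolding B_def using that by (intro add_right_mono Max_ge) auto
  have "rat_padic_abs p (X n) \<le> B" for n
  proof (cases "n \<le> N")
    case True
    thus ?thesis using le[of n] by simp
  next
    case False
    hence "rat_padic_abs p (X n) \<le> rat_padic_abs p (X N) + 1"
      using N[of n N] rat_padic_abs_diff3[of "X n" "X N"] by linarith
    thus ?thesis using le[of N] by simp
  qed
  moreover have "B > 0" using le[of 0] rat_padic_abs_nonneg[of "X 0"] by simp
  ultimately show ?thesis using that by blast
qed

lemma padic_cauchy_const [simp]: "padic_cauchy p (\<lambda>_. c)"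
  by (simp add: padic_cauchy_def)

lemma padic_cauchy_minus: "padic_cauchy p X \<Longrightarrow> padic_cauchy p (\<lambda>n. - X n)"
  unfolding padic_cauchy_def
  by (metis (no_types, opaque_lifting) minus_diff_minus rat_padic_abs_minus)

lemma padic_cauchy_add:
  assumes "padic_cauchy p X" "padic_cauchy p Y"
  shows "padic_cauchy p (\<lambda>n. X n + Y n)"
  unfolding padic_cauchy_def
proof (intro allI impI)
  fix \<epsilon> :: real assume e: "\<epsilon> > 0"
  hence "\<epsilon> / 2 > 0" by simp
  then obtain M N where
    MN: "\<And>m n. m \<ge> M \<Longrightarrow> n \<ge> M \<Longrightarrow> rat_padic_abs p (X m - X n) < \<epsilon> / 2"
        "\<And>m n. m \<ge> N \<Longrightarrow> n \<ge> N \<Longrightarrow> rat_padic_abs p (Y m - Y n) < \<epsilon> / 2"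
    using assms unfolding padic_cauchy_def by meson
  have "rat_padic_abs p (X m + Y m - (X n + Y n)) < \<epsilon>" if "m \<ge> max M N" "n \<ge> max M N" for m n
    using rat_padic_abs_add_le[of "X m - X n" "Y m - Y n"] MN(1)[of m n] MN(2)[of m n] that
    by (simp add: algebra_simps)
  thus "\<exists>N. \<forall>m\<ge>N. \<forall>n\<ge>N. rat_padic_abs p (X m + Y m - (X n + Y n)) < \<epsilon>" by blast
qed

lemma padic_cauchy_mult:
  assumes X: "padic_cauchy p X" and Y: "padic_cauchy p Y"
  shows "padic_cauchy p (\<lambda>n. X n * Y n)"
  unfolding padic_cauchy_def
proof (intro allI impI)
  fix \<epsilon> :: real assume e: "\<epsilon> > 0"
  obtain A where A: "A > 0" "\<And>n. rat_padic_abs p (X n) \<le> A" by (rule padic_cauchy_bounded[OF X]) blast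
  obtain B where B: "B > 0" "\<And>n. rat_padic_abs p (Y n) \<le> B" by (rule padic_cauchy_bounded[OF Y]) blast
  define \<delta> where "\<delta> = \<epsilon> / (2 * (A + B))"
  have d: "\<delta> > 0" using e A B by (simp add: \<delta>_def)
  then obtain M N where
    MN: "\<And>m n. m \<ge> M \<Longrightarrow> n \<ge> M \<Longrightarrow> rat_padic_abs p (X m - X n) < \<delta>"
        "\<And>m n. m \<ge> N \<Longrightarrow> n \<ge> N \<Longrightarrow> rat_padic_abs p (Y m - Y n) < \<delta>"
    using assms unfolding padic_cauchy_def by meson
  have "rat_padic_abs p (X m * Y m - X n * Y n) < \<epsilon>" if mn: "m \<ge> max M N" "n \<ge> max M N" for m n
  proof -
    have "X m * Y m - X n * Y n = X m * (Y m - Y n) + (X m - X n) * Y n"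
      by (simp add: algebra_simps)
    hence "rat_padic_abs p (X m * Y m - X n * Y n) \<le>
       rat_padic_abs p (X m) * rat_padic_abs p (Y m - Y n) +
       rat_padic_abs p (X m - X n) * rat_padic_abs p (Y n)"
      using rat_padic_abs_add_le[of "X m * (Y m - Y n)" "(X m - X n) * Y n"]
      by (simp add: rat_padic_abs_mult)
    also have "\<dots> \<le> A * \<delta> + \<delta> * B"
      using MN(1)[of m n] MN(2)[of m n] mn A B d rat_padic_abs_nonneg
      by (intro add_mono mult_mono) (auto intro: less_imp_le)
    also have "\<dots> = (A + B) * \<delta>" by (simp add: algebra_simps)
    also have "\<dots> = \<epsilon> / 2" using A(1) B(1) add_pos_pos[OF A(1) B(1)]
      unfolding \<delta>_def by (simp add: divide_simps) (simp add: algebra_simps)?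
    finally show ?thesis using e by simp
  qed
  thus "\<exists>N. \<forall>m\<ge>N. \<forall>n\<ge>N. rat_padic_abs p (X m * Y m - X n * Y n) < \<epsilon>" by blast
qed

lemma padic_null_comparison:
  assumes "g \<longlonglongrightarrow> 0" "\<And>n. rat_padic_abs p (X n) \<le> g n"
  shows "padic_null p X"
  unfolding padic_null_def
  by (rule tendsto_sandwich[OF _ _ tendsto_const assms(1)])
     (auto simp: rat_padic_abs_nonneg assms(2))

lemma padic_null_add:
  assumes "padic_null p X" "padic_null p Y"
  shows "padic_null p (\<lambda>n. X n + Y n)"
proof -
  have "(\<lambda>n. rat_padic_abs p (X n) + rat_padic_abs p (Y n)) \<longlonglongrightarrow> 0"
    using tendsto_add[of _ 0 _ _ 0] assms unfolding padic_null_def by force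
  thus ?thesis by (rule padic_null_comparison) (rule rat_padic_abs_add_le)
qed

lemma padic_null_minus: "padic_null p X \<Longrightarrow> padic_null p (\<lambda>n. - X n)"
  by (simp add: padic_null_def)

lemma padic_null_zero [simp]: "padic_null p (\<lambda>n. 0)"
  by (simp add: padic_null_def)

lemma padic_null_mult:
  assumes X: "padic_cauchy p X" and "padic_null p Y"
  shows "padic_null p (\<lambda>n. X n * Y n)"
proof -
  obtain A where A: "A > 0" "\<And>n. rat_padic_abs p (X n) \<le> A" by (rule padic_cauchy_bounded[OF X]) blast
  have "(\<lambda>n. A * rat_padic_abs p (Y n)) \<longlonglongrightarrow> 0"
    using tendsto_mult_right_zero assms(2) unfolding padic_null_def by blast
  thus ?thesis
    by (rule padic_null_comparison)
       (auto simp: rat_padic_abs_nonneg rat_padic_abs_mult A intro!: mult_right_mono)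
qed

lemma padic_abs_convergent:
  assumes "padic_cauchy p X"
  shows "convergent (\<lambda>n. rat_padic_abs p (X n))"
proof -
  have "Cauchy (\<lambda>n. rat_padic_abs p (X n))"
    unfolding Cauchy_def
  proof (intro allI impI)
    fix \<epsilon> :: real assume "\<epsilon> > 0"
    then obtain N where N: "\<And>m n. m \<ge> N \<Longrightarrow> n \<ge> N \<Longrightarrow> rat_padic_abs p (X m - X n) < \<epsilon>"
      using assms unfolding padic_cauchy_def by meson
    have "dist (rat_padic_abs p (X m)) (rat_padic_abs p (X n)) < \<epsilon>" if "m \<ge> N" "n \<ge> N" for m n
      using N[OF that] N[OF that(2,1)] rat_padic_abs_diff3[of "X m" "X n"]
        rat_padic_abs_diff3[of "X n" "X m"]
      by (simp add: dist_real_def)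
    thus "\<exists>M. \<forall>m\<ge>M. \<forall>n\<ge>M. dist (rat_padic_abs p (X m)) (rat_padic_abs p (X n)) < \<epsilon>" by blast
  qed
  thus ?thesis by (simp add: Cauchy_convergent_iff)
qed

lemma padic_not_null_bound:
  assumes X: "padic_cauchy p X" and "\<not> padic_null p X"
  obtains c N where "c > 0" "\<And>n. n \<ge> N \<Longrightarrow> rat_padic_abs p (X n) > c"
proof -
  obtain L where L: "(\<lambda>n. rat_padic_abs p (X n)) \<longlonglongrightarrow> L"
    using padic_abs_convergent[OF X] by (auto simp: convergent_def)
  have "L \<ge> 0" by (rule LIMSEQ_le_const[OF L]) (auto simp: rat_padic_abs_nonneg)
  moreover have "L \<noteq> 0" using L assms(2) by (auto simp: padic_null_def)
  ultimately have "L / 2 > 0" "L / 2 < L" by auto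
  from order_tendstoD(1)[OF L this(2)] this(1) show ?thesis
    using that unfolding eventually_sequentially by blast
qed

lemma padic_cauchy_inverse:
  assumes X: "padic_cauchy p X" and nX: "\<not> padic_null p X"
  shows "padic_cauchy p (\<lambda>n. inverse (X n))"
  unfolding padic_cauchy_def
proof (intro allI impI)
  fix \<epsilon> :: real assume e: "\<epsilon> > 0"
  obtain c N where c: "c > 0" "\<And>n. n \<ge> N \<Longrightarrow> rat_padic_abs p (X n) > c"
    using padic_not_null_bound[OF X nX] by blast
  have "\<epsilon> * (c * c) > 0" using e c by simp
  then obtain M where M: "\<And>m n. m \<ge> M \<Longrightarrow> n \<ge> M \<Longrightarrow> rat_padic_abs p (X m - X n) < \<epsilon> * (c * c)"
    using X unfolding padic_cauchy_def by meson
  have "rat_padic_abs p (inverse (X m) - inverse (X n)) < \<epsilon>"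
    if mn: "m \<ge> max M N" "n \<ge> max M N" for m n
  proof -
    have cm: "rat_padic_abs p (X m) > c" "rat_padic_abs p (X n) > c" using c mn by auto
    hence nz: "X m \<noteq> 0" "X n \<noteq> 0" using c(1) by auto
    have "(X n - X m) = (inverse (X m) - inverse (X n)) * (X m * X n)"
      using nz by (simp add: field_simps)
    hence "rat_padic_abs p (X n - X m) =
      rat_padic_abs p (inverse (X m) - inverse (X n)) * (rat_padic_abs p (X m) * rat_padic_abs p (X n))"
      by (simp add: rat_padic_abs_mult)
    moreover have "\<dots> \<ge> rat_padic_abs p (inverse (X m) - inverse (X n)) * (c * c)"
      using cm c(1) by (intro mult_left_mono mult_mono) (auto simp: rat_padic_abs_nonneg)
    moreover have "rat_padic_abs p (X n - X m) < \<epsilon> * (c * c)" using M mn by auto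
    ultimately have "rat_padic_abs p (inverse (X m) - inverse (X n)) * (c * c) < \<epsilon> * (c * c)"
      by linarith
    thus ?thesis using c(1) by simp
  qed
  thus "\<exists>N. \<forall>m\<ge>N. \<forall>n\<ge>N. rat_padic_abs p (inverse (X m) - inverse (X n)) < \<epsilon>" by blast
qed

end


section \<open>The field of \<open>p\<close>-adic numbers\<close>

text \<open>
  \<open>'p padic\<close> is the completion of the rationals with respect to the \<open>p\<close>-adic absolute value,
  for the prime \<open>p = CARD('p)\<close>: Cauchy sequences modulo null sequences.
\<close>

definition padic_rel :: "'p::prime_card itself \<Rightarrow> (nat \<Rightarrow> rat) \<Rightarrow> (nat \<Rightarrow> rat) \<Rightarrow> bool" where
  "padic_rel _ X Y \<longleftrightarrow> padic_cauchy CARD('p) X \<and> padic_cauchy CARD('p) Y \<and>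
     padic_null CARD('p) (\<lambda>n. X n - Y n)"

lemma padic_rel_refl: "padic_rel TYPE('p::prime_card) X X \<longleftrightarrow> padic_cauchy CARD('p) X"
  by (auto simp: padic_rel_def padic_null_zero[OF prime_card])

lemma padic_rel_part_equivp: "part_equivp (padic_rel TYPE('p::prime_card))"
proof (rule part_equivpI)
  show "\<exists>X. padic_rel TYPE('p) X X"
    using padic_cauchy_const[OF prime_card] by (auto simp: padic_rel_refl)
  show "symp (padic_rel TYPE('p))"
    by (rule sympI) (auto simp: padic_rel_def dest: padic_null_minus[OF prime_card])
  show "transp (padic_rel TYPE('p))"
    by (rule transpI) (auto simp: padic_rel_def dest: padic_null_add[OF prime_card])
qed

typedef (overloaded) ('p::prime_card) padic =
  "{C. \<exists>X. padic_rel TYPE('p) X X \<and> C = Collect (padic_rel TYPE('p) X)}"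
  morphisms class_of_padic padic_of_class
  using part_equivpE[OF padic_rel_part_equivp[where 'p = 'p]] by blast

interpretation padic: quot_type
  "padic_rel TYPE('p::prime_card)" "padic_of_class :: _ \<Rightarrow> 'p padic" class_of_padic
  by (rule quot_type.intro)
     (use padic_rel_part_equivp class_of_padic in \<open>auto simp: class_of_padic_inverse
        class_of_padic_inject intro!: padic_of_class_inverse\<close>)

definition cr_padic :: "(nat \<Rightarrow> rat) \<Rightarrow> 'p::prime_card padic \<Rightarrow> bool" where
  "cr_padic X x \<longleftrightarrow> padic_rel TYPE('p) X X \<and> padic.abs X = x"

lemma Quotient_padic:
  "Quotient (padic_rel TYPE('p::prime_card)) padic.abs padic.rep (cr_padic :: _ \<Rightarrow> 'p padic \<Rightarrow> bool)"
  by (rule Quotient3_to_Quotient[OF padic.Quotient]) (rule eq_reflection, simp add: cr_padic_def fun_eq_iff)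

setup_lifting Quotient_padic

instantiation padic :: (prime_card) field
begin

lift_definition zero_padic :: "'a padic" is "\<lambda>_. 0"
  by (simp add: padic_rel_refl prime_card)

lift_definition one_padic :: "'a padic" is "\<lambda>_. 1"
  by (simp add: padic_rel_refl prime_card)

lift_definition plus_padic :: "'a padic \<Rightarrow> 'a padic \<Rightarrow> 'a padic" is "\<lambda>X Y n. X n + Y n"
  unfolding padic_rel_def
  by (auto intro: padic_cauchy_add[OF prime_card] simp: add_diff_add
      intro!: padic_null_add[OF prime_card])

lift_definition uminus_padic :: "'a padic \<Rightarrow> 'a padic" is "\<lambda>X n. - X n"
  unfolding padic_rel_def
  by (auto intro: padic_cauchy_minus[OF prime_card]
      dest: padic_null_minus[OF prime_card])

lift_definition times_padic :: "'a padic \<Rightarrow> 'a padic \<Rightarrow> 'a padic" is "\<lambda>X Y n. X n * Y n"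
proof -
  fix X X' Y Y' :: "nat \<Rightarrow> rat"
  assume X: "padic_rel TYPE('a) X X'" and Y: "padic_rel TYPE('a) Y Y'"
  have "padic_null CARD('a) (\<lambda>n. X n * (Y n - Y' n) + Y' n * (X n - X' n))"
    using X Y unfolding padic_rel_def
    by (intro padic_null_add[OF prime_card] padic_null_mult[OF prime_card]) auto
  thus "padic_rel TYPE('a) (\<lambda>n. X n * Y n) (\<lambda>n. X' n * Y' n)"
    using X Y by (auto simp: padic_rel_def algebra_simps intro: padic_cauchy_mult[OF prime_card])
qed

lift_definition inverse_padic :: "'a padic \<Rightarrow> 'a padic" is
  "\<lambda>X. if padic_null CARD('a) X then (\<lambda>_. 0) else (\<lambda>n. inverse (X n))"
proof -
  fix X Y :: "nat \<Rightarrow> rat"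
  assume XY: "padic_rel TYPE('a) X Y"
  note pc = prime_card[where 'a = 'a]
  have cX: "padic_cauchy CARD('a) X" and cY: "padic_cauchy CARD('a) Y"
    and n: "padic_null CARD('a) (\<lambda>n. X n - Y n)" using XY by (auto simp: padic_rel_def)
  have n': "padic_null CARD('a) (\<lambda>n. Y n - X n)" using padic_null_minus[OF pc n] by simp
  have iff: "padic_null CARD('a) X \<longleftrightarrow> padic_null CARD('a) Y"
    using padic_null_add[OF pc n, of Y] padic_null_add[OF pc n', of X] by auto
  show "padic_rel TYPE('a)
     (if padic_null CARD('a) X then (\<lambda>_. 0) else (\<lambda>n. inverse (X n)))
     (if padic_null CARD('a) Y then (\<lambda>_. 0) else (\<lambda>n. inverse (Y n)))"
  proof (cases "padic_null CARD('a) X")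
    case True
    thus ?thesis using iff by (simp add: padic_rel_refl pc)
  next
    case False
    have iX: "padic_cauchy CARD('a) (\<lambda>n. inverse (X n))"
      and iY: "padic_cauchy CARD('a) (\<lambda>n. inverse (Y n))"
      using padic_cauchy_inverse[OF pc] cX cY False iff by auto
    have "padic_null CARD('a) (\<lambda>n. (inverse (X n) * inverse (Y n)) * (Y n - X n))"
      by (intro padic_null_mult[OF pc] padic_cauchy_mult[OF pc] iX iY n')
    moreover have "\<forall>\<^sub>F n in sequentially. (inverse (X n) * inverse (Y n)) * (Y n - X n) =
                     inverse (X n) - inverse (Y n)"
    proof -
      obtain c N where c: "c > 0" "\<And>n. n \<ge> N \<Longrightarrow> rat_padic_abs CARD('a) (X n) > c"
        using padic_not_null_bound[OF pc cX False] by blast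
      obtain d M where d: "d > 0" "\<And>n. n \<ge> M \<Longrightarrow> rat_padic_abs CARD('a) (Y n) > d"
        using padic_not_null_bound[OF pc cY] False iff by blast
      have "X n \<noteq> 0 \<and> Y n \<noteq> 0" if "n \<ge> max M N" for n
        using c(1) c(2)[of n] d(1) d(2)[of n] that rat_padic_abs_0[OF pc] by auto
      thus ?thesis unfolding eventually_sequentially
        by (intro exI[of _ "max M N"]) (auto simp: field_simps)
    qed
    ultimately have "padic_null CARD('a) (\<lambda>n. inverse (X n) - inverse (Y n))"
      unfolding padic_null_def
      by (elim Lim_transform_eventually) (auto elim: eventually_mono)
    thus ?thesis using False iff iX iY by (simp add: padic_rel_def)
  qed
qed

definition minus_padic :: "'a padic \<Rightarrow> 'a padic \<Rightarrow> 'a padic" where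
  "minus_padic x y = x + (- y)"

definition divide_padic :: "'a padic \<Rightarrow> 'a padic \<Rightarrow> 'a padic" where
  "divide_padic x y = x * inverse y"

instance
proof
  note pc = prime_card[where 'a = 'a]
  fix a b c :: "'a padic"
  show "a * b * c = a * (b * c)"
    by transfer (auto simp: padic_rel_def mult.assoc pc intro!: padic_cauchy_mult[OF pc])
  show "a * b = b * a"
    by transfer (auto simp: padic_rel_def mult.commute pc intro!: padic_cauchy_mult[OF pc])
  show "1 * a = a"
    by transfer (auto simp: padic_rel_def pc)
  show "a + b + c = a + (b + c)"
    by transfer (auto simp: padic_rel_def add.assoc pc intro!: padic_cauchy_add[OF pc])
  show "a + b = b + a"
    by transfer (auto simp: padic_rel_def add.commute pc intro!: padic_cauchy_add[OF pc])
  show "0 + a = a"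
    by transfer (auto simp: padic_rel_def pc)
  show "- a + a = 0"
    by transfer (auto simp: padic_rel_def pc)
  show "a - b = a + - b"
    by (simp add: minus_padic_def)
  show "(a + b) * c = a * c + b * c"
    by transfer (auto simp: padic_rel_def distrib_right pc
        intro!: padic_cauchy_mult[OF pc] padic_cauchy_add[OF pc])
  show "(0 :: 'a padic) \<noteq> 1"
    by transfer (auto simp: padic_rel_def padic_null_def pc LIMSEQ_const_iff)
  show "inverse (0 :: 'a padic) = 0"
    by transfer (auto simp: padic_rel_def pc)
  show "a div b = a * inverse b"
    by (simp add: divide_padic_def)
  show "a \<noteq> 0 \<Longrightarrow> inverse a * a = 1"
  proof transfer
    fix X :: "nat \<Rightarrow> rat"
    assume X: "padic_rel TYPE('a) X X" and nz: "\<not> padic_rel TYPE('a) X (\<lambda>_. 0)"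
    have cX: "padic_cauchy CARD('a) X" using X by (simp add: padic_rel_refl)
    have nX: "\<not> padic_null CARD('a) X" using nz cX by (auto simp: padic_rel_def pc)
    obtain c N where c: "c > 0" "\<And>n. n \<ge> N \<Longrightarrow> rat_padic_abs CARD('a) (X n) > c"
      using padic_not_null_bound[OF pc cX nX] by blast
    have "X n \<noteq> 0" if "n \<ge> N" for n
      using c(1) c(2)[OF that] rat_padic_abs_0[OF pc] by auto
    hence "\<forall>\<^sub>F n in sequentially. rat_padic_abs CARD('a) (inverse (X n) * X n - 1) = 0"
      unfolding eventually_sequentially by (intro exI[of _ N]) (auto simp: rat_padic_abs_0[OF pc])
    hence "padic_null CARD('a) (\<lambda>n. inverse (X n) * X n - 1)"
      unfolding padic_null_def by (rule tendsto_eventually)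
    thus "padic_rel TYPE('a)
       (\<lambda>n. (if padic_null CARD('a) X then \<lambda>_. 0 else (\<lambda>n. inverse (X n))) n * X n) (\<lambda>_. 1)"
      using nX cX padic_cauchy_inverse[OF pc cX nX]
      by (auto simp: padic_rel_def pc intro!: padic_cauchy_mult[OF pc])
  qed
qed

end

lift_definition padic_abs :: "'p::prime_card padic \<Rightarrow> real" is
  "\<lambda>X. lim (\<lambda>n. rat_padic_abs CARD('p) (X n))"
proof -
  fix X Y :: "nat \<Rightarrow> rat"
  assume XY: "padic_rel TYPE('p) X Y"
  note pc = prime_card[where 'a = 'p]
  obtain L where L: "(\<lambda>n. rat_padic_abs CARD('p) (Y n)) \<longlonglongrightarrow> L"
    using padic_abs_convergent[OF pc] XY by (auto simp: padic_rel_def convergent_def)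
  have n: "(\<lambda>n. rat_padic_abs CARD('p) (X n - Y n)) \<longlonglongrightarrow> 0"
    using XY by (simp add: padic_rel_def padic_null_def)
  have "(\<lambda>n. rat_padic_abs CARD('p) (X n) - rat_padic_abs CARD('p) (Y n)) \<longlonglongrightarrow> 0"
  proof (rule tendsto_rabs_zero_cancel, rule tendsto_sandwich[OF _ _ tendsto_const n])
    have "\<bar>rat_padic_abs CARD('p) (X k) - rat_padic_abs CARD('p) (Y k)\<bar>
            \<le> rat_padic_abs CARD('p) (X k - Y k)" for k
      using rat_padic_abs_diff3[OF pc, of "X k" "Y k"] rat_padic_abs_diff3[OF pc, of "Y k" "X k"]
        rat_padic_abs_minus[OF pc, of "X k - Y k"] by (simp add: abs_le_iff)
    thus "\<forall>\<^sub>F k in sequentially. \<bar>rat_padic_abs CARD('p) (X k) - rat_padic_abs CARD('p) (Y k)\<bar>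
            \<le> rat_padic_abs CARD('p) (X k - Y k)" by simp
  qed simp
  from tendsto_add[OF this L] have "(\<lambda>n. rat_padic_abs CARD('p) (X n)) \<longlonglongrightarrow> L" by simp
  thus "lim (\<lambda>n. rat_padic_abs CARD('p) (X n)) = lim (\<lambda>n. rat_padic_abs CARD('p) (Y n))"
    using L by (simp add: limI)
qed


section \<open>Finite extensions, ramification index and residue class degree\<close>

text \<open>
  A finite extension of \<open>'p padic\<close> is a field \<open>'k\<close> with an embedding \<open>\<iota>\<close>
  of finite degree.
\<close>

definition finite_padic_extension :: "('p::prime_card padic \<Rightarrow> 'k::field) \<Rightarrow> bool" where
  "finite_padic_extension \<iota> \<longleftrightarrow>
     field_hom \<iota> \<and> (\<exists>B. finite_dimensional_vector_space (\<lambda>a x. \<iota> a * x) B)"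

definition extends_padic_abs :: "('p::prime_card padic \<Rightarrow> 'k::field) \<Rightarrow> ('k \<Rightarrow> real) \<Rightarrow> bool" where
  "extends_padic_abs \<iota> v \<longleftrightarrow>
     (\<forall>x. v x \<ge> 0) \<and> (\<forall>x. v x = 0 \<longleftrightarrow> x = 0) \<and>
     (\<forall>x y. v (x * y) = v x * v y) \<and>
     (\<forall>x y. v (x + y) \<le> max (v x) (v y)) \<and>
     (\<forall>a. v (\<iota> a) = padic_abs a)"

definition value_group :: "('k::field \<Rightarrow> real) \<Rightarrow> real monoid" where
  "value_group v = \<lparr>carrier = v ` (UNIV - {0}), monoid.mult = (*), one = 1\<rparr>"

definition ramification_index ::
  "('p::prime_card padic \<Rightarrow> 'k::field) \<Rightarrow> ('k \<Rightarrow> real) \<Rightarrow> nat" where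
  "ramification_index \<iota> v =
     card (rcosets\<^bsub>value_group v\<^esub> (carrier (value_group (padic_abs :: 'p padic \<Rightarrow> real))))"

definition valuation_ring :: "('k::field \<Rightarrow> real) \<Rightarrow> 'k ring" where
  "valuation_ring v = \<lparr>carrier = {x. v x \<le> 1}, monoid.mult = (*), one = 1, zero = 0, add = (+)\<rparr>"

definition residue_field :: "('k::field \<Rightarrow> real) \<Rightarrow> 'k set ring" where
  "residue_field v = valuation_ring v Quot {x. v x < 1}"

text \<open>
  The residue field of the \<open>p\<close>-adic numbers is regarded as a subfield of the residue
  field of the extension: it consists of the residue classes of the images of the \<open>p\<close>-adic
  integers.
\<close>

definition residue_subfield ::
  "('p::prime_card padic \<Rightarrow> 'k::field) \<Rightarrow> ('k \<Rightarrow> real) \<Rightarrow> 'k set set" where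
  "residue_subfield \<iota> v =
     (\<lambda>a. {x. v x < 1} +>\<^bsub>valuation_ring v\<^esub> \<iota> a) ` carrier (valuation_ring padic_abs)"

definition has_residue_degree ::
  "('p::prime_card padic \<Rightarrow> 'k::field) \<Rightarrow> ('k \<Rightarrow> real) \<Rightarrow> nat \<Rightarrow> bool" where
  "has_residue_degree \<iota> v f \<longleftrightarrow>
     ring.dimension (residue_field v) f (residue_subfield \<iota> v) (carrier (residue_field v))"

text \<open>
  For a finite extension there is exactly one absolute value \<open>v\<close> extending the \<open>p\<close>-adic one,
  so that \<open>e\<close> and \<open>f\<close> are determined by \<open>\<iota>\<close>.
\<close>

definition has_ramification_and_residue_degree ::
  "('p::prime_card padic \<Rightarrow> 'k::field) \<Rightarrow> nat \<Rightarrow> nat \<Rightarrow> bool" where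
  "has_ramification_and_residue_degree \<iota> e f \<longleftrightarrow>
     (\<exists>v. extends_padic_abs \<iota> v \<and> ramification_index \<iota> v = e \<and> has_residue_degree \<iota> v f)"


section \<open>Roots of fewnomials\<close>

definition num_terms :: "'k::zero poly \<Rightarrow> nat" where
  "num_terms g = card {i. coeff g i \<noteq> 0}"

text \<open>The number of non-zero roots of a non-zero polynomial, counted with multiplicities.\<close>

definition num_nonzero_roots :: "'k::field poly \<Rightarrow> nat" where
  "num_nonzero_roots g = (\<Sum>x | x \<noteq> 0 \<and> poly g x = 0. order x g)"

definition B_m :: "nat \<Rightarrow> 'k::field itself \<Rightarrow> enat" where
  "B_m t _ = (SUP g \<in> {g :: 'k poly. g \<noteq> 0 \<and> num_terms g \<le> t + 1}. enat (num_nonzero_roots g))"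

end

theory Submission
  imports Defs
begin

text \<open>
  Write \<open>q = p\<^sup>f\<close> for the size of the residue field of \<open>K\<close> and \<open>M\<close> for the maximal ideal
  \<open>{x. v x < 1}\<close>. The elements of \<open>K\<close> of one given non-zero absolute value fall into \<open>q - 1\<close>
  cosets \<open>r(1 + M)\<close>, and the proof counts roots coset by coset.

  Upper bound. If \<open>g(z) = f(r + rz)\<close> and \<open>N\<close> is the last index at which \<open>|g\<^sub>k|\<rho>\<^sup>k\<close> is maximal,
  then \<open>f\<close> has at most \<open>N\<close> roots \<open>r + rz\<close> with \<open>|z| \<le> \<rho>\<close> (lemma
  \<open>sum_order_le_last_dominant\<close>). For a polynomial with \<open>t + 1\<close> terms, \<open>k! g\<^sub>k\<close> is an integral
  combination of \<open>0! g\<^sub>0, \<dots>, t! g\<^sub>t\<close>, and \<open>p > e + t\<close> is just what keeps \<open>\<rho>\<^sup>k\<^sup>-\<^sup>t\<close> below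
  \<open>|k!|\<close>. So there are at most \<open>t\<close> roots per coset (\<open>roots_in_coset_le_terms\<close>), two for a
  trinomial. If all roots have the same absolute value, this gives \<open>2(q - 1)\<close>. Otherwise the
  Newton polygon has two edges, which a priori gives \<open>4(q - 1)\<close>. But the two edge lengths are
  differences of exponents, and on the edge whose length is at least as large \<open>p\<close>-adically a coset
  contains only one root (\<open>edge_roots_in_coset_le_one\<close>): the linear coefficient of \<open>g\<close> has the
  size of that length, which divides every \<open>k! g\<^sub>k\<close>. The total is \<open>q - 1 + 2(q - 1)\<close>.

  Lower bound. With \<open>a = p\<^sup>q\<^sup>-\<^sup>1\<close>, the trinomial \<open>1 - (1 + a)y\<^sup>a + a y\<^sup>a\<^sup>+\<^sup>1\<close> has a double zero at
  \<open>y = 1\<close> and a zero close to \<open>1/a\<close>. Both \<open>1\<close> and \<open>1/a\<close> are \<open>(q-1)\<close>-st powers, so after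
  substituting \<open>y = x\<^sup>q\<^sup>-\<^sup>1\<close> there are \<open>q - 1\<close> double roots, namely the roots of unity, and, by
  Hensel's lemma, \<open>q - 1\<close> further roots of absolute value \<open>|1/p|\<close>.

  It remains to see that \<open>K\<close> has the properties used here: it is complete, being finite-dimensional
  over the complete field of \<open>p\<close>-adic numbers (\<open>v_complete_extension\<close>), the \<open>e\<close>-th power of every
  value is a \<open>p\<close>-adic value (\<open>v_power_ramification_index\<close>), and its residue field has \<open>p\<^sup>f\<close>
  elements (\<open>card_residue_field\<close>).
\<close>

section \<open>Non-archimedean absolute values\<close>

locale nonarchimedean =
  fixes v :: "'k::field \<Rightarrow> real"
  assumes v_nonneg [simp]: "v x \<ge> 0"
    and v_eq_0 [simp]: "v x = 0 \<longleftrightarrow> x = 0"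
    and v_mult: "v (x * y) = v x * v y"
    and v_add: "v (x + y) \<le> max (v x) (v y)"
begin

lemma v_zero [simp]: "v 0 = 0"
  by simp

lemma v_pos: "x \<noteq> 0 \<Longrightarrow> v x > 0"
  by (metis less_eq_real_def v_nonneg v_eq_0)

lemma v_one [simp]: "v 1 = 1"
  using v_mult[of 1 1] v_pos[of 1] by simp

lemma v_minus [simp]: "v (- x) = v x"
proof -
  have "v (-1) * v (-1) = 1" using v_mult[of "-1" "-1"] by simp
  hence "v (-1) = 1"
    by (metis abs_1 abs_of_nonneg power2_eq_square real_sqrt_abs real_sqrt_one v_nonneg)
  thus ?thesis using v_mult[of "-1" x] by simp
qed

lemma v_minus_commute: "v (x - y) = v (y - x)"
  by (metis minus_diff_eq v_minus)

lemma v_diff: "v (x - y) \<le> max (v x) (v y)"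
  using v_add[of x "- y"] by simp

lemma v_power: "v (x ^ n) = v x ^ n"
  by (induction n) (auto simp: v_mult)

lemma v_inverse: "v (inverse x) = inverse (v x)"
proof (cases "x = 0")
  case False
  then have "v x * v (inverse x) = 1" by (simp flip: v_mult)
  thus ?thesis by (simp add: inverse_unique)
qed simp

lemma v_divide: "v (x / y) = v x / v y"
  by (simp add: divide_inverse v_mult v_inverse)

lemma v_add_le: "v x \<le> c \<Longrightarrow> v y \<le> c \<Longrightarrow> v (x + y) \<le> c"
  using v_add[of x y] by linarith

lemma v_add_less: "v x < c \<Longrightarrow> v y < c \<Longrightarrow> v (x + y) < c"
  using v_add[of x y] by linarith

lemma v_diff_le: "v x \<le> c \<Longrightarrow> v y \<le> c \<Longrightarrow> v (x - y) \<le> c"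
  using v_diff[of x y] by linarith

lemma v_diff_less: "v x < c \<Longrightarrow> v y < c \<Longrightarrow> v (x - y) < c"
  using v_diff[of x y] by linarith

lemma v_add_dominant: "v y < v x \<Longrightarrow> v (x + y) = v x"
  using v_add[of x y] v_diff[of "x + y" y] by (auto simp: max_def split: if_splits)

lemma v_eq_of_diff_less: "v (x - y) < v y \<Longrightarrow> v x = v y"
  using v_add_dominant[of "x - y" y] by simp

lemma v_sum_less:
  assumes "\<And>i. i \<in> I \<Longrightarrow> v (g i) < c" "c > 0"
  shows "v (sum g I) < c"
  using assms(1) by (induction I rule: infinite_finite_induct) (auto simp: assms(2) intro: v_add_less)

lemma v_of_nat_le: "v (of_nat n) \<le> 1"
  by (induction n) (auto intro: v_add_le)

lemma v_of_int_le: "v (of_int n) \<le> 1"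
  by (cases n rule: int_cases2) (auto simp: v_of_nat_le)

lemma v_mult_le_1: "v x \<le> 1 \<Longrightarrow> v y \<le> 1 \<Longrightarrow> v (x * y) \<le> 1"
  by (simp add: v_mult mult_le_one)

lemma v_poly_le_1: "(\<And>i. v (coeff h i) \<le> 1) \<Longrightarrow> v x \<le> 1 \<Longrightarrow> v (poly h x) \<le> 1"
proof (induction h)
  case (pCons c h)
  have "v (coeff h i) \<le> 1" for i using pCons.prems(1)[of "Suc i"] by simp
  hence "v (poly h x) \<le> 1" by (rule pCons.IH) (use pCons in auto)
  thus ?case using pCons.prems(1)[of 0] pCons.prems(2)
    by (auto intro!: v_add_le v_mult_le_1)
qed simp

text \<open>
  The Newton polygon of \<open>h\<close> at radius \<open>\<rho>\<close>, reduced to what root counting needs: \<open>N\<close> is the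
  last index at which \<open>|h\<^sub>i| \<rho>\<^sup>i\<close> is maximal.
\<close>

definition last_dominant :: "real \<Rightarrow> 'k poly \<Rightarrow> nat \<Rightarrow> bool" where
  "last_dominant \<rho> h N \<longleftrightarrow>
     (\<forall>i\<le>N. v (coeff h i) * \<rho> ^ i \<le> v (coeff h N) * \<rho> ^ N) \<and>
     (\<forall>i>N. v (coeff h i) * \<rho> ^ i < v (coeff h N) * \<rho> ^ N)"

lemma last_dominant_le:
  assumes "last_dominant \<rho> h N"
    and "\<And>k. k > t \<Longrightarrow> \<exists>i\<le>t. v (coeff h k) * \<rho> ^ k < v (coeff h i) * \<rho> ^ i"
  shows "N \<le> t"
proof (rule ccontr)
  assume "\<not> N \<le> t"
  then obtain i where "i \<le> t" "v (coeff h N) * \<rho> ^ N < v (coeff h i) * \<rho> ^ i"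
    using assms(2)[of N] by auto
  thus False using assms(1) \<open>\<not> N \<le> t\<close> unfolding last_dominant_def
    by (meson leI le_trans not_less order_less_imp_le)
qed

lemma last_dominant_exists:
  assumes "h \<noteq> 0" "\<rho> > 0"
  obtains N where "last_dominant \<rho> h N"
proof -
  define m where "m = Max ((\<lambda>i. v (coeff h i) * \<rho> ^ i) ` {..degree h})"
  define N where "N = Max {i \<in> {..degree h}. v (coeff h i) * \<rho> ^ i = m}"
  have "m \<in> (\<lambda>i. v (coeff h i) * \<rho> ^ i) ` {..degree h}"
    unfolding m_def by (intro Max_in) auto
  hence ne: "{i \<in> {..degree h}. v (coeff h i) * \<rho> ^ i = m} \<noteq> {}" by auto
  have N: "N \<le> degree h" "v (coeff h N) * \<rho> ^ N = m"
    using Max_in[OF _ ne] unfolding N_def by auto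
  have le: "v (coeff h i) * \<rho> ^ i \<le> m" if "i \<le> degree h" for i
    unfolding m_def using that by (intro Max_ge) auto
  have "v (lead_coeff h) * \<rho> ^ degree h > 0" using assms by (simp add: v_pos)
  hence m: "m > 0" using le[of "degree h"] by linarith
  have gt: "v (coeff h i) * \<rho> ^ i < m" if "i > N" for i
  proof (cases "i \<le> degree h")
    case True
    have "v (coeff h i) * \<rho> ^ i \<noteq> m"
    proof
      assume "v (coeff h i) * \<rho> ^ i = m"
      hence "i \<le> N" unfolding N_def using True by (intro Max_ge) auto
      thus False using that by simp
    qed
    thus ?thesis using le[OF True] by simp
  next
    case False
    thus ?thesis using m by (simp add: coeff_eq_0)
  qed
  have "last_dominant \<rho> h N"
    unfolding last_dominant_def N(2) using gt le N(1) by auto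
  thus ?thesis by (rule that)
qed

text \<open>
  Gauss's lemma for one linear factor: if the root of the factor has absolute value at most \<open>\<rho>\<close>,
  the factor is dominated by its leading term, and dominant terms multiply.
\<close>

lemma last_dominant_linear_mult:
  assumes h: "last_dominant \<rho> h N" and \<rho>: "\<rho> > 0" and "d \<noteq> 0" and c: "v c \<le> v d * \<rho>"
  shows "last_dominant \<rho> ([:c, d:] * h) (Suc N)"
proof -
  define w where "w i = v (coeff h i) * \<rho> ^ i" for i
  have dpos: "v d * \<rho> > 0" using v_pos[OF \<open>d \<noteq> 0\<close>] \<rho> by simp
  have wle: "w i \<le> w N" for i
    using h unfolding last_dominant_def w_def by (metis less_eq_real_def not_le)
  have wlt: "w i < w N" if "i > N" for i
    using h that unfolding last_dominant_def w_def by auto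
  have prod: "coeff ([:c, d:] * h) k = c * coeff h k + (if k = 0 then 0 else d * coeff h (k - 1))" for k
    by (cases k) (auto simp: coeff_pCons)
  have first: "v (c * coeff h k) * \<rho> ^ k \<le> v d * \<rho> * w k" for k
    using mult_right_mono[OF c, of "w k"] \<rho> by (simp add: w_def v_mult mult_ac)
  have second: "v (d * coeff h i) * \<rho> ^ Suc i = v d * \<rho> * w i" for i
    by (simp add: w_def v_mult mult_ac)
  have sum_le: "v (x + y) * \<rho> ^ k \<le> max (v x * \<rho> ^ k) (v y * \<rho> ^ k)" for x y k
  proof -
    have "v (x + y) * \<rho> ^ k \<le> max (v x) (v y) * \<rho> ^ k"
      using v_add[of x y] \<rho> by (intro mult_right_mono) auto
    thus ?thesis using \<rho> by (auto simp: max_def split: if_splits)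
  qed
  have top: "v (coeff ([:c, d:] * h) (Suc N)) * \<rho> ^ Suc N = v d * \<rho> * w N"
  proof -
    have "v (c * coeff h (Suc N)) * \<rho> ^ Suc N < v (d * coeff h N) * \<rho> ^ Suc N"
      using first[of "Suc N"] second[of N] mult_strict_left_mono[OF wlt[of "Suc N"] dpos] by linarith
    hence "v (c * coeff h (Suc N)) < v (d * coeff h N)"
      using \<rho> by (simp add: mult_less_cancel_right)
    from v_add_dominant[OF this] show ?thesis
      using second[of N] unfolding prod by (simp add: add.commute)
  qed
  have bound: "v (coeff ([:c, d:] * h) k) * \<rho> ^ k \<le> max (v d * \<rho> * w k) (if k = 0 then 0 else v d * \<rho> * w (k - 1))" for k
  proof (cases k)
    case 0
    thus ?thesis using first[of 0] unfolding prod by (simp add: le_max_iff_disj)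
  next
    case (Suc i)
    thus ?thesis
      using sum_le[of "c * coeff h k" "d * coeff h i" k] first[of k]
      unfolding Suc second unfolding prod by simp
  qed
  have mono: "v d * \<rho> * w i \<le> v d * \<rho> * w N" for i
    using wle[of i] dpos by (intro mult_left_mono) auto
  have smono: "v d * \<rho> * w i < v d * \<rho> * w N" if "i > N" for i
    using wlt[OF that] dpos by (intro mult_strict_left_mono) auto
  show ?thesis
    unfolding last_dominant_def top
  proof (intro conjI allI impI)
    fix i
    have "v d * \<rho> * w N \<ge> 0" using dpos \<rho> by (simp add: w_def)
    thus "v (coeff ([:c, d:] * h) i) * \<rho> ^ i \<le> v d * \<rho> * w N"
      using bound[of i] mono[of i] mono[of "i - 1"] by (auto split: if_splits)
    assume "Suc N < i"
    hence "N < i" "N < i - 1" "i \<noteq> 0" by auto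
    thus "v (coeff ([:c, d:] * h) i) * \<rho> ^ i < v d * \<rho> * w N"
      using bound[of i] smono[of i] smono[of "i - 1"] by (simp del: mult_pCons_left)
  qed
qed

text \<open>
  Splitting off the roots \<open>x = r + rz\<close> in \<open>S\<close> one at a time turns each of them into a linear factor
  \<open>(r - x) + rz\<close> of the shifted polynomial, and each such factor raises the dominant index by one.
  No extension of the absolute value to a splitting field is involved.
\<close>

lemma sum_order_le_last_dominant:
  assumes "g \<noteq> 0" "finite S" "\<rho> > 0" "r \<noteq> 0"
    and "\<And>x. x \<in> S \<Longrightarrow> v (x - r) \<le> v r * \<rho>"
    and "last_dominant \<rho> (g \<circ>\<^sub>p [:r, r:]) N"
  shows "(\<Sum>x\<in>S. order x g) \<le> N"
  using assms(1,6)
proof (induction "\<Sum>x\<in>S. order x g" arbitrary: g N)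
  case 0
  thus ?case by simp
next
  case (Suc n g N)
  have "\<exists>x\<in>S. order x g \<noteq> 0"
    using Suc(2) by (metis Zero_not_Suc sum.neutral)
  then obtain x where x: "x \<in> S" "poly g x = 0" by (auto simp: order_root)
  then obtain h where g: "g = [:-x, 1:] * h" by (auto simp: poly_eq_0_iff_dvd)
  hence h: "h \<noteq> 0" using Suc by auto
  have ord: "order y g = (if y = x then 1 else 0) + order y h" for y
  proof -
    have "order y [:-x, 1:] = count (proots [:-x, 1:]) y" by (subst count_proots) auto
    also have "\<dots> = (if y = x then 1 else 0)" by (simp only: proots_linear_factor) auto
    finally show ?thesis using Polynomial.order_mult[OF Suc.prems(1)[unfolded g], of y] unfolding g by argo
  qed
  have sum: "(\<Sum>y\<in>S. order y g) = Suc (\<Sum>y\<in>S. order y h)"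
    using x assms(2) by (simp add: ord sum.distrib)
  have "h \<circ>\<^sub>p [:r, r:] \<noteq> 0" using h assms(4) by (simp add: pcompose_eq_0_iff)
  then obtain M where M: "last_dominant \<rho> (h \<circ>\<^sub>p [:r, r:]) M"
    using last_dominant_exists assms(3) by blast
  have eq: "g \<circ>\<^sub>p [:r, r:] = [:r - x, r:] * (h \<circ>\<^sub>p [:r, r:])"
    by (simp only: g pcompose_mult) (simp add: pcompose_pCons)
  have "v (r - x) \<le> v r * \<rho>" using assms(5)[OF x(1)] by (simp add: v_minus_commute)
  from last_dominant_linear_mult[OF M assms(3,4) this]
  have SM: "last_dominant \<rho> (g \<circ>\<^sub>p [:r, r:]) (Suc M)" by (simp only: eq)
  have "N = Suc M"
    using SM Suc.prems(2) unfolding last_dominant_def by (metis leD le_less_linear not_less_iff_gr_or_eq)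
  moreover have "(\<Sum>y\<in>S. order y h) \<le> M"
    using Suc(1)[OF _ h M] Suc(2) sum by simp
  ultimately show ?case using sum by simp
qed

text \<open>
  The remainder is \<open>z\<^sup>2\<close> times an integral polynomial expression; this is Taylor's formula without
  division by \<open>2\<close>.
\<close>

lemma v_taylor_remainder:
  assumes "\<And>i. v (coeff h i) \<le> 1" "v x \<le> 1" "v z \<le> 1"
  shows "v (poly h (x + z) - poly h x - poly (pderiv h) x * z) \<le> v z ^ 2"
  using assms(1)
proof (induction h)
  case (pCons c h)
  have h: "v (coeff h i) \<le> 1" for i using pCons.prems(1)[of "Suc i"] by simp
  have "v (coeff (pderiv h) i) \<le> 1" for i
    using h[of "Suc i"] v_of_nat_le[of "Suc i"] by (auto simp: coeff_pderiv intro: v_mult_le_1)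
  hence d: "v (poly (pderiv h) x) \<le> 1" by (rule v_poly_le_1) (use assms in auto)
  have "poly (pCons c h) (x + z) - poly (pCons c h) x - poly (pderiv (pCons c h)) x * z =
     (x + z) * (poly h (x + z) - poly h x - poly (pderiv h) x * z) + z ^ 2 * poly (pderiv h) x"
    by (simp add: pderiv_pCons algebra_simps power2_eq_square)
  moreover have "v ((x + z) * (poly h (x + z) - poly h x - poly (pderiv h) x * z)) \<le> v z ^ 2"
    using mult_mono[OF v_add_le[OF assms(2,3)] pCons.IH[OF h]] by (simp add: v_mult)
  moreover have "v (z ^ 2 * poly (pderiv h) x) \<le> v z ^ 2"
    using mult_left_mono[OF d, of "v z ^ 2"] by (simp add: v_mult v_power)
  ultimately show ?case by (simp only: v_add_le)
qed simp

end

definition v_complete_on :: "('k::field \<Rightarrow> real) \<Rightarrow> 'k set \<Rightarrow> bool" where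
  "v_complete_on v S \<longleftrightarrow> (\<forall>X. range X \<subseteq> S \<and> (\<forall>\<epsilon>>0. \<exists>N. \<forall>m\<ge>N. \<forall>n\<ge>N. v (X m - X n) < \<epsilon>) \<longrightarrow>
     (\<exists>L\<in>S. (\<lambda>n. v (X n - L)) \<longlonglongrightarrow> 0))"

abbreviation v_complete :: "('k::field \<Rightarrow> real) \<Rightarrow> bool" where
  "v_complete v \<equiv> v_complete_on v UNIV"

context nonarchimedean
begin

text \<open>
  Newton's iteration with the derivative frozen at the starting point. Convergence is then linear
  instead of quadratic, with factor \<open>\<rho> = |h(x)|\<close>, but the iteration needs no control of a changing
  denominator.
\<close>

lemma hensel:
  assumes complete: "v_complete v"
    and h: "\<And>i. v (coeff h i) \<le> 1" and x: "v x \<le> 1"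
    and root: "v (poly h x) < 1" and simple: "v (poly (pderiv h) x) = 1"
  obtains y where "poly h y = 0" "v (y - x) < 1"
proof -
  define \<rho> where "\<rho> = v (poly h x)"
  have \<rho>: "0 \<le> \<rho>" "\<rho> < 1" using root by (auto simp: \<rho>_def)
  define d where "d = poly (pderiv h) x"
  have d: "v d = 1" "d \<noteq> 0" using simple by (auto simp: d_def)
  define X where "X = rec_nat x (\<lambda>_ u. u - poly h u / d)"
  have X0: "X 0 = x" and XS: "X (Suc n) = X n - poly h (X n) / d" for n
    by (simp_all add: X_def)
  have dint: "v (coeff (pderiv h) i) \<le> 1" for i
    using h[of "Suc i"] v_of_nat_le[of "Suc i"] by (auto simp: coeff_pderiv intro: v_mult_le_1)
  have lip: "v (poly g (u + z) - poly g u) \<le> v z"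
    if g: "\<And>i. v (coeff g i) \<le> 1" and uz: "v u \<le> 1" "v z \<le> 1" for g u z
    using g
  proof (induction g)
    case (pCons c g)
    have g: "v (coeff g i) \<le> 1" for i using pCons.prems(1)[of "Suc i"] by simp
    have "poly (pCons c g) (u + z) - poly (pCons c g) u = 
          z * poly g (u + z) + u * (poly g (u + z) - poly g u)" by (simp add: algebra_simps)
    moreover have "v (z * poly g (u + z)) \<le> v z"
      using mult_left_mono[OF v_poly_le_1[OF g v_add_le[OF uz]], of "v z"] by (simp add: v_mult)
    moreover have "v (u * (poly g (u + z) - poly g u)) \<le> v z"
      using mult_mono[OF uz(1) pCons.IH[OF g]] by (simp add: v_mult)
    ultimately show ?case by (simp only: v_add_le)
  qed simp
  have step: "v (X n - x) \<le> \<rho> \<and> v (poly h (X n)) \<le> \<rho> ^ Suc n" for n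
  proof (induction n)
    case 0
    show ?case using \<rho> by (simp add: X0 \<rho>_def)
  next
    case (Suc n)
    define z where "z = - (poly h (X n) / d)"
    have Xz: "X (Suc n) = X n + z" by (simp add: XS z_def)
    have "\<rho> ^ Suc n \<le> \<rho>" using \<rho> by (simp add: power_le_one mult_left_le)
    hence z: "v z \<le> \<rho> ^ Suc n" "v z \<le> \<rho>" using Suc d by (auto simp: z_def v_divide)
    have "X (Suc n) - x = (X n - x) + z" by (simp add: Xz)
    hence 1: "v (X (Suc n) - x) \<le> \<rho>" using Suc z by (simp only: v_add_le)
    have Xn: "v (X n) \<le> 1" using v_add_le[of "X n - x" 1 x] Suc \<rho> x by simp
    have "v (poly (pderiv h) (x + (X n - x)) - poly (pderiv h) x) \<le> v (X n - x)"
      using Suc \<rho> by (intro lip dint x) auto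
    hence dd: "v (poly (pderiv h) (X n) - d) \<le> \<rho>" using Suc by (simp add: d_def)
    have zz: "z * d = - poly h (X n)" using d by (simp add: z_def)
    have "poly h (X (Suc n)) = (poly h (X n + z) - poly h (X n) - poly (pderiv h) (X n) * z)
            + (poly (pderiv h) (X n) - d) * z"
      using zz by (simp add: Xz algebra_simps)
    moreover have "v (poly h (X n + z) - poly h (X n) - poly (pderiv h) (X n) * z) \<le> \<rho> * \<rho> ^ Suc n"
    proof -
      have "v (poly h (X n + z) - poly h (X n) - poly (pderiv h) (X n) * z) \<le> v z ^ 2"
        using z \<rho> by (intro v_taylor_remainder h Xn) auto
      also have "\<dots> \<le> \<rho> * \<rho> ^ Suc n"
        using mult_mono[OF z(2,1)] \<rho> by (simp add: power2_eq_square)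
      finally show ?thesis .
    qed
    moreover have "v ((poly (pderiv h) (X n) - d) * z) \<le> \<rho> * \<rho> ^ Suc n"
      using mult_mono[OF dd z(1)] \<rho> by (simp add: v_mult)
    ultimately have "v (poly h (X (Suc n))) \<le> \<rho> ^ Suc (Suc n)" by (simp only: v_add_le power_Suc)
    thus ?case using 1 by simp
  qed
  have diff: "v (X (m + k) - X m) \<le> \<rho> ^ Suc m" for m k
  proof (induction k)
    case 0
    show ?case using \<rho> by simp
  next
    case (Suc k)
    have "\<rho> ^ Suc (m + k) \<le> \<rho> ^ Suc m" using \<rho> by (intro power_decreasing) auto
    hence "v (- (poly h (X (m + k)) / d)) \<le> \<rho> ^ Suc m"
      using step[of "m + k"] d by (simp add: v_divide)
    from v_add_le[OF Suc this] show ?case by (simp add: XS algebra_simps)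
  qed
  have cauchy: "\<exists>N. \<forall>m\<ge>N. \<forall>n\<ge>N. v (X m - X n) < \<epsilon>" if \<epsilon>: "\<epsilon> > 0" for \<epsilon>
  proof -
    obtain N where N: "\<rho> ^ N < \<epsilon>" using real_arch_pow_inv[OF \<epsilon> \<rho>(2)] by auto
    have "\<rho> ^ Suc N \<le> \<rho> ^ N" using \<rho> by (simp add: mult_left_le_one_le)
    hence "v (X n - X N) < \<epsilon>" if "n \<ge> N" for n
      using diff[of N "n - N"] that N by simp
    hence "v ((X m - X N) - (X n - X N)) < \<epsilon>" if "m \<ge> N" "n \<ge> N" for m n
      using that by (intro v_diff_less[of "X m - X N" _ "X n - X N"])
    thus ?thesis by auto
  qed
  then obtain y where y: "(\<lambda>n. v (X n - y)) \<longlonglongrightarrow> 0"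
    using complete unfolding v_complete_on_def by blast
  have "eventually (\<lambda>n. v (X n - y) < 1) sequentially"
    using order_tendstoD(2)[OF y, of 1] by simp
  then obtain n where "v (X n - y) < 1" by (auto simp: eventually_sequentially)
  moreover have "v (X n - x) < 1" using step[of n] \<rho> by simp
  ultimately have yx: "v (y - x) < 1" using v_diff_less[of "X n - x" 1 "X n - y"] by simp
  have yn: "v (poly h y) \<le> max (v (X n - y)) (\<rho> ^ Suc n)" if n: "v (X n - y) < 1" for n
  proof -
    have "v y \<le> 1" using v_add_le[of "y - x" 1 x] yx x by simp
    hence "v (poly h (y + (X n - y)) - poly h y) \<le> v (X n - y)"
      using n by (intro lip h) auto
    from v_diff[of "poly h (X n)" "poly h (X n) - poly h y"] this step[of n] show ?thesis by auto
  qed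
  have "(\<lambda>n. \<rho> ^ Suc n) \<longlonglongrightarrow> 0" using \<rho> LIMSEQ_Suc[OF LIMSEQ_realpow_zero[of \<rho>]] by simp
  from tendsto_max[OF y this] have lim: "(\<lambda>n. max (v (X n - y)) (\<rho> ^ Suc n)) \<longlonglongrightarrow> 0" by simp
  have "v (poly h y) \<le> 0"
    by (rule tendsto_lowerbound[OF lim])
       (use order_tendstoD(2)[OF y, of 1] in \<open>auto elim!: eventually_mono intro: yn simp del: power_Suc\<close>)
  hence "poly h y = 0" using v_nonneg[of "poly h y"] by (metis antisym v_eq_0)
  thus ?thesis using yx that by blast
qed

end

section \<open>Falling factorials\<close>

text \<open>
  The coefficients of \<open>f(r + rz)\<close> are sums of binomial coefficients \<open>n choose k\<close> over the exponents
  \<open>n\<close> of \<open>f\<close>. Multiplied by \<open>k!\<close> they are values at \<open>n\<close> of a monic integral polynomial, for which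
  congruences and division with remainder are available.
\<close>

definition falling_fact :: "nat \<Rightarrow> int \<Rightarrow> int" where
  "falling_fact k n = (\<Prod>i<k. n - int i)"

lemma falling_fact_0 [simp]: "falling_fact 0 n = 1"
  and falling_fact_Suc: "falling_fact (Suc k) n = falling_fact k n * (n - int k)"
  by (simp_all add: falling_fact_def)

lemma falling_fact_binomial: "falling_fact k (int n) = int (fact k * (n choose k))"
proof (induction k)
  case (Suc k)
  have "Suc k * (n choose Suc k) = (n choose k) * (n - k)"
    by (metis Suc_times_binomial_eq binomial_absorb_comp binomial_absorption mult.commute)
  hence "int (fact (Suc k) * (n choose Suc k)) = int (fact k) * int ((n choose k) * (n - k))"
    by (simp only: fact_Suc of_nat_id mult_ac flip: of_nat_mult)
  also have "int ((n choose k) * (n - k)) = int (n choose k) * (int n - int k)"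
    by (cases "k \<le> n") (auto simp: of_nat_diff)
  finally show ?case using Suc by (simp add: falling_fact_Suc)
qed simp

lemma falling_fact_diff_dvd: "m - n dvd falling_fact k m - falling_fact k n"
proof (induction k)
  case (Suc k)
  have "falling_fact (Suc k) m - falling_fact (Suc k) n =
     (falling_fact k m - falling_fact k n) * (m - int k) + falling_fact k n * (m - n)"
    by (simp add: falling_fact_Suc algebra_simps)
  thus ?case using Suc by simp
qed simp

text \<open>
  The integral polynomial functions of degree less than \<open>d\<close>. They are generated from falling
  factorials because membership is only ever used to transport a bound from the first \<open>d\<close>
  coefficients of a shifted polynomial to all others, by induction on the generation.
\<close>

inductive_set falling_span :: "nat \<Rightarrow> (int \<Rightarrow> int) set" for d :: nat where
  zero: "(\<lambda>_. 0) \<in> falling_span d"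
| falling: "i < d \<Longrightarrow> falling_fact i \<in> falling_span d"
| add: "g \<in> falling_span d \<Longrightarrow> h \<in> falling_span d \<Longrightarrow> (\<lambda>x. g x + h x) \<in> falling_span d"
| scale: "g \<in> falling_span d \<Longrightarrow> (\<lambda>x. c * g x) \<in> falling_span d"

lemma falling_span_mult_linear:
  assumes "g \<in> falling_span d"
  shows "(\<lambda>x. (x - c) * g x) \<in> falling_span (Suc d)"
  using assms
proof induction
  case zero
  show ?case by (simp add: falling_span.zero)
next
  case (falling i)
  have "(\<lambda>x. falling_fact (Suc i) x + (int i - c) * falling_fact i x) \<in> falling_span (Suc d)"
    using falling by (intro falling_span.intros) auto
  thus ?case by (simp add: falling_fact_Suc algebra_simps)
next
  case (add g h)
  have "(\<lambda>x. (x - c) * g x + (x - c) * h x) \<in> falling_span (Suc d)"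
    using add by (intro falling_span.add)
  thus ?case by (simp add: algebra_simps)
next
  case (scale g k)
  have "(\<lambda>x. k * ((x - c) * g x)) \<in> falling_span (Suc d)"
    using scale by (intro falling_span.scale)
  thus ?case by (simp add: algebra_simps)
qed

lemma prod_linear_falling_span:
  assumes "finite E"
  shows "\<exists>g\<in>falling_span (card E). \<forall>x. (\<Prod>j\<in>E. x - j) = falling_fact (card E) x + g x"
  using assms
proof induction
  case empty
  show ?case by (auto intro: falling_span.zero)
next
  case (insert j E)
  define d where "d = card E"
  obtain g where g: "g \<in> falling_span d" "\<And>x. (\<Prod>j\<in>E. x - j) = falling_fact d x + g x"
    using insert unfolding d_def by auto
  have "(\<lambda>x. (int d - j) * falling_fact d x + (x - j) * g x) \<in> falling_span (Suc d)"
    using falling_span_mult_linear[OF g(1)] by (intro falling_span.intros) auto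
  moreover have "(\<Prod>j\<in>insert j E. x - j) =
      falling_fact (Suc d) x + ((int d - j) * falling_fact d x + (x - j) * g x)" for x
    using insert by (simp add: g(2) falling_fact_Suc algebra_simps)
  ultimately show ?case using insert by (auto simp: d_def)
qed

text \<open>
  Division with remainder by the monic polynomial \<open>\<Prod>j\<in>E. x - j\<close>, which vanishes on \<open>E\<close>: on a set
  of \<open>d\<close> integers every falling factorial is an integral combination of the first \<open>d\<close> ones.
\<close>

lemma falling_fact_on_finite:
  assumes "finite E"
  shows "\<exists>g\<in>falling_span (card E). \<forall>x\<in>E. falling_fact k x = g x"
proof (induction k)
  case 0
  show ?case
  proof (cases "card E = 0")
    case True
    thus ?thesis using assms by (auto intro: falling_span.zero)
  next
    case False
    hence "falling_fact 0 \<in> falling_span (card E)" by (intro falling_span.falling) auto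
    thus ?thesis by (intro bexI[of _ "falling_fact 0"]) auto
  qed
next
  case (Suc k)
  define d where "d = card E"
  obtain m where m: "m \<in> falling_span d" "\<And>x. (\<Prod>j\<in>E. x - j) = falling_fact d x + m x"
    using prod_linear_falling_span[OF assms] by (auto simp: d_def)
  \<comment> \<open>On \<open>E\<close> the falling factorial of degree \<open>d\<close> equals \<open>- m\<close>, so degree \<open>d\<close> can be lowered.\<close>
  have red: "\<exists>h\<in>falling_span d. \<forall>x\<in>E. g x = h x" if "g \<in> falling_span (Suc d)" for g
    using that
  proof induction
    case (falling i)
    show ?case
    proof (cases "i < d")
      case True
      thus ?thesis using falling_span.falling by blast
    next
      case False
      hence "i = d" using falling by simp
      have "falling_fact d x = (-1) * m x" if "x \<in> E" for x
        using m(2)[of x] that assms by (simp add: prod_zero[of E] eq_neg_iff_add_eq_0)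
      thus ?thesis using \<open>i = d\<close>
        by (intro bexI[OF _ falling_span.scale[OF m(1), of "-1"]]) auto
    qed
  next
    case (add g h)
    then obtain g' h' where "g' \<in> falling_span d" "\<forall>x\<in>E. g x = g' x"
        "h' \<in> falling_span d" "\<forall>x\<in>E. h x = h' x" by blast
    thus ?case by (intro bexI[of _ "\<lambda>x. g' x + h' x"] falling_span.add) auto
  next
    case (scale g c)
    then obtain g' where "g' \<in> falling_span d" "\<forall>x\<in>E. g x = g' x" by blast
    thus ?case by (intro bexI[of _ "\<lambda>x. c * g' x"] falling_span.scale) auto
  qed (auto intro: falling_span.zero)
  obtain g where g: "g \<in> falling_span d" "\<And>x. x \<in> E \<Longrightarrow> falling_fact k x = g x"
    using Suc by (auto simp: d_def)
  obtain h where "h \<in> falling_span d" "\<And>x. x \<in> E \<Longrightarrow> (x - int k) * g x = h x"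
    using red[OF falling_span_mult_linear[OF g(1), of "int k"]] by auto
  thus ?case using g(2) unfolding d_def
    by (intro bexI[of _ h]) (auto simp: falling_fact_Suc mult.commute)
qed

section \<open>The multiplicity of a prime in a factorial\<close>

lemma multiplicity_fact_prime_mult:
  assumes "prime (p::nat)"
  shows "multiplicity p (fact (p * m)) = m + multiplicity p (fact m)"
proof (induction m)
  case (Suc m)
  have p: "p > 0" using assms prime_gt_0_nat by blast
  have pe: "prime_elem p" using assms by simp
  have step: "multiplicity p (fact (p * m + j)) = multiplicity p (fact (p * m))" if "j < p" for j
    using that
  proof (induction j)
    case (Suc j)
    have "\<not> p dvd p * m + Suc j" using Suc
      by (metis dvd_add_right_iff dvd_triv_left nat_dvd_not_less zero_less_Suc)
    hence "multiplicity p (p * m + Suc j) = 0" by (rule not_dvd_imp_multiplicity_0)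
    hence "multiplicity p ((p * m + Suc j) * fact (p * m + j)) = multiplicity p (fact (p * m + j))"
      by (subst prime_elem_multiplicity_mult_distrib[OF pe]) auto
    thus ?case using Suc by (simp add: fact_Suc)
  qed simp
  have "p * Suc m = Suc (p * m + (p - 1))" using p by simp
  hence "(fact (p * Suc m) :: nat) = p * Suc m * fact (p * m + (p - 1))"
    by (metis fact_Suc of_nat_id)
  hence "multiplicity p (fact (p * Suc m)) =
      multiplicity p (p * Suc m) + multiplicity p (fact (p * m + (p - 1)))"
    using p by (simp add: prime_elem_multiplicity_mult_distrib[OF pe] del: mult_Suc_right)
  also have "multiplicity p (p * Suc m) = Suc (multiplicity p (Suc m))"
    using p by (subst prime_elem_multiplicity_mult_distrib[OF pe]) (auto simp: multiplicity_prime[OF pe])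
  also have "multiplicity p (fact (p * m + (p - 1))) = m + multiplicity p (fact m)"
    using step[of "p - 1"] p Suc by simp
  finally show ?case
    using prime_elem_multiplicity_mult_distrib[OF pe, of "Suc m" "fact m"] by simp
qed simp

text \<open>
  Legendre's estimate \<open>v\<^sub>p(k!) \<le> (k - 1)/(p - 1)\<close>, written without division.
\<close>

lemma multiplicity_fact_bound:
  assumes p: "prime (p::nat)"
  shows "k > 0 \<Longrightarrow> (p - 1) * multiplicity p (fact k) < k"
proof (induction k rule: less_induct)
  case (less k)
  have p1: "p > 1" using p prime_gt_1_nat by blast
  have pe: "prime_elem p" using p by simp
  show ?case
  proof (cases "p dvd k")
    case True
    then obtain m where k: "k = p * m" by blast
    have m: "m > 0" "m < k" using k less p1 by auto
    have "(p - 1) * multiplicity p (fact k) = (p - 1) * m + (p - 1) * multiplicity p (fact m)"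
      unfolding k multiplicity_fact_prime_mult[OF p] by (simp add: distrib_left)
    also have "\<dots> < (p - 1) * m + m" using less.IH[OF m(2,1)] by simp
    also have "\<dots> = k" using p1 by (simp add: k algebra_simps)
    finally show ?thesis .
  next
    case False
    obtain j where k: "k = Suc j" using less by (cases k) auto
    have "multiplicity p (fact k) = multiplicity p (fact j)"
      using False unfolding k fact_Suc of_nat_id
      by (subst prime_elem_multiplicity_mult_distrib[OF pe]) (auto simp: not_dvd_imp_multiplicity_0)
    thus ?thesis using less.IH[of j] k by (cases "j = 0") auto
  qed
qed

section \<open>Roots in a coset of the principal units\<close>

text \<open>
  The assumption \<open>ramified\<close> is how the ramification index \<open>e\<close> enters the root counts: no element of
  the maximal ideal is closer to being a unit than an \<open>e\<close>-th root of \<open>p\<close>.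
\<close>

locale low_ramification = nonarchimedean v for v :: "'k::field \<Rightarrow> real" +
  fixes p e :: nat
  assumes prime_p: "prime p"
    and v_p_less_1: "v (of_nat p) < 1"
    and v_p_pos: "0 < v (of_nat p)"
    and e_pos: "e > 0"
    and ramified: "v x < 1 \<Longrightarrow> v x ^ e \<le> v (of_nat p)"
begin

text \<open>
  Bezout: a multiple of \<open>n\<close> is congruent to \<open>1\<close> modulo \<open>p\<close>.
\<close>

lemma v_of_nat_coprime:
  assumes "\<not> p dvd n"
  shows "v (of_nat n) = 1"
proof -
  have "coprime (int n) (int p)"
    using prime_imp_coprime[OF prime_p assms] by (simp add: coprime_commute)
  then obtain a b where ab: "a * int n + b * int p = 1"
    using bezout_int[of "int n" "int p"] by auto
  have "of_int a * of_nat n + of_int b * of_nat p = (of_int (a * int n + b * int p) :: 'k)"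
    by simp
  also have "\<dots> = 1" by (simp only: ab of_int_1)
  finally have eq: "of_int a * of_nat n + of_int b * of_nat p = (1::'k)" .
  have "v (of_int b * of_nat p) < 1"
    using mult_right_mono[OF v_of_int_le[of b], of "v (of_nat p)"] v_p_less_1 by (simp add: v_mult)
  hence "\<not> v (of_int a * of_nat n) < 1"
    using v_add_less[of "of_int a * of_nat n" 1 "of_int b * of_nat p"] eq by auto
  moreover have "v (of_int a * of_nat n) \<le> v (of_nat n)"
    using mult_right_mono[OF v_of_int_le[of a], of "v (of_nat n)"] by (simp add: v_mult)
  ultimately show ?thesis using v_of_nat_le[of n] by linarith
qed

lemma v_of_nat:
  assumes "n > 0"
  shows "v (of_nat n) = v (of_nat p) ^ multiplicity p n"
proof -
  obtain m where m: "n = p ^ multiplicity p n * m" "\<not> p dvd m"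
    using multiplicity_decompose'[of n p] assms prime_p by (metis not_prime_unit not_gr_zero)
  have "v (of_nat (p ^ multiplicity p n * m)) = v (of_nat p) ^ multiplicity p n"
    using v_of_nat_coprime[OF m(2)] by (simp add: v_mult v_power)
  thus ?thesis using m(1) by simp
qed

lemma v_of_nat_pos: "n > 0 \<Longrightarrow> v (of_nat n) > 0"
  by (subst v_of_nat) (auto simp: v_p_pos)

lemma v_of_int_pos: "z \<noteq> 0 \<Longrightarrow> v (of_int z) > 0"
  by (cases z rule: int_cases2) (auto intro: v_of_nat_pos)

text \<open>
  If \<open>p\<close> divides \<open>k!\<close> exactly \<open>m\<close> times, Legendre's estimate and \<open>p - 1 \<ge> e + t\<close> give
  \<open>(e + t) m < k\<close>, hence \<open>e m < k - t\<close>. This is the only place where the size of \<open>p\<close> is used.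
\<close>

lemma power_less_v_fact:
  assumes p: "p > e + t" and k: "k > t" and \<rho>: "\<rho> \<ge> 0" "\<rho> ^ e \<le> v (of_nat p)"
  shows "\<rho> ^ (k - t) < v (of_nat (fact k))"
proof -
  define m where "m = multiplicity p (fact k :: nat)"
  have "(e + t) * m \<le> (p - 1) * m" using p by (intro mult_right_mono) auto
  also have "\<dots> < k" using multiplicity_fact_bound[OF prime_p, of k] k by (simp add: m_def)
  finally have "(e + t) * m < k" .
  hence em: "e * m < k - t"
    using k by (cases m) (auto simp: algebra_simps)
  have "(\<rho> ^ (k - t)) ^ e = (\<rho> ^ e) ^ (k - t)" by (simp flip: power_mult add: mult.commute)
  also have "\<dots> \<le> v (of_nat p) ^ (k - t)" using \<rho> by (intro power_mono) auto
  also have "\<dots> < v (of_nat p) ^ (e * m)"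
    using em v_p_pos v_p_less_1 by (intro power_strict_decreasing) auto
  also have "\<dots> = v (of_nat (fact k)) ^ e"
    using v_of_nat[of "fact k"] by (simp add: m_def mult.commute flip: power_mult)
  finally show ?thesis by (rule power_less_imp_less_base) simp
qed

text \<open>
  Only finitely many roots are counted, so a disc of radius \<open>\<rho> < 1\<close> around \<open>r\<close> contains them all, and
  \<open>\<rho>\<close> may be chosen as an actual value, which makes \<open>ramified\<close> applicable to it.
\<close>

lemma coset_root_bound:
  assumes f: "f \<noteq> 0" and S: "finite S" and r: "r \<noteq> 0"
    and near: "\<And>x. x \<in> S \<Longrightarrow> v (x - r) < v r"
    and dom: "\<And>\<rho> k. \<rho> > 0 \<Longrightarrow> \<rho> ^ e \<le> v (of_nat p) \<Longrightarrow> k > t \<Longrightarrow>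
       \<exists>i\<le>t. v (coeff (f \<circ>\<^sub>p [:r, r:]) k) * \<rho> ^ k < v (coeff (f \<circ>\<^sub>p [:r, r:]) i) * \<rho> ^ i"
  shows "(\<Sum>x\<in>S. order x f) \<le> t"
proof -
  \<comment> \<open>The value of \<open>p\<close> is thrown in because \<open>\<rho>\<close> has to be positive even if all roots equal \<open>r\<close>.\<close>
  define \<rho> where "\<rho> = Max (insert (v (of_nat p)) ((\<lambda>x. v (x - r) / v r) ` S))"
  have vr: "v r > 0" using r by (rule v_pos)
  have fin: "finite (insert (v (of_nat p)) ((\<lambda>x. v (x - r) / v r) ` S))" using S by simp
  have ge: "v (of_nat p) \<le> \<rho>" unfolding \<rho>_def by (intro Max_ge fin) auto
  hence pos: "\<rho> > 0" using v_p_pos by linarith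
  have "\<rho> \<in> insert (v (of_nat p)) ((\<lambda>x. v (x - r) / v r) ` S)"
    unfolding \<rho>_def by (intro Max_in fin) auto
  then consider "\<rho> = v (of_nat p)" | x where "x \<in> S" "\<rho> = v ((x - r) / r)"
    by (auto simp: v_divide)
  hence "\<exists>z. \<rho> = v z \<and> v z < 1"
  proof cases
    case 2
    moreover have "v ((x - r) / r) < 1" using near[OF 2(1)] vr by (simp add: v_divide)
    ultimately show ?thesis by blast
  qed (use v_p_less_1 in blast)
  hence re: "\<rho> ^ e \<le> v (of_nat p)" using ramified by auto
  have le: "v (x - r) \<le> v r * \<rho>" if "x \<in> S" for x
  proof -
    have "v (x - r) / v r \<le> \<rho>" unfolding \<rho>_def using that by (intro Max_ge fin) auto
    thus ?thesis using vr by (simp add: field_simps)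
  qed
  have "f \<circ>\<^sub>p [:r, r:] \<noteq> 0" using f r by (simp add: pcompose_eq_0_iff)
  then obtain N where N: "last_dominant \<rho> (f \<circ>\<^sub>p [:r, r:]) N"
    using last_dominant_exists pos by blast
  have "(\<Sum>x\<in>S. order x f) \<le> N"
    by (rule sum_order_le_last_dominant[OF f S pos r le N])
  also have "N \<le> t" by (rule last_dominant_le[OF N dom[OF pos re]])
  finally show ?thesis .
qed

lemma coeff_shift_scale:
  fixes f :: "'k poly"
  assumes "finite E" "{n. coeff f n \<noteq> 0} \<subseteq> E"
  shows "of_nat (fact k) * coeff (f \<circ>\<^sub>p [:r, r:]) k =
     (\<Sum>n\<in>E. coeff f n * r ^ n * of_int (falling_fact k (int n)))"
proof -
  have one: "coeff (monom c n \<circ>\<^sub>p [:r, r:]) k = c * r ^ n * of_nat (n choose k)" for c :: 'k and n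
  proof (cases "k \<le> n")
    case True
    have "r ^ k * r ^ (n - k) = r ^ n" using True by (simp flip: power_add)
    thus ?thesis using True
      by (simp add: pcompose_altdef poly_monom map_poly_monom coeff_linear_poly_power mult_ac)
  next
    case False
    have "degree ([:r, r:] ^ n) \<le> n" using degree_power_le[of "[:r, r:]" n] by (auto split: if_splits)
    hence "coeff ([:r, r:] ^ n) k = 0" using False by (intro coeff_eq_0) simp
    thus ?thesis using False
      by (simp add: pcompose_altdef poly_monom map_poly_monom binomial_eq_0)
  qed
  have "f = (\<Sum>n\<in>E. monom (coeff f n) n)"
  proof (rule poly_eqI)
    fix i
    have "coeff (\<Sum>n\<in>E. monom (coeff f n) n) i = (\<Sum>n\<in>E. if n = i then coeff f n else 0)"
      by (simp add: coeff_sum)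
    also have "\<dots> = coeff f i" using assms by (auto simp: sum.delta)
    finally show "coeff f i = coeff (\<Sum>n\<in>E. monom (coeff f n) n) i" by simp
  qed
  hence "coeff (f \<circ>\<^sub>p [:r, r:]) k = (\<Sum>n\<in>E. coeff f n * r ^ n * of_nat (n choose k))"
    by (metis (mono_tags, lifting) coeff_sum one pcompose_sum sum.cong)
  moreover have "(of_int (falling_fact k (int n)) :: 'k) = of_nat (fact k) * of_nat (n choose k)" for n
    by (simp only: falling_fact_binomial of_int_of_nat_eq flip: of_nat_mult)
  ultimately show ?thesis
    by (simp only: sum_distrib_left mult_ac)
qed

lemma v_falling_span_sum:
  assumes "g \<in> falling_span d"
    and "\<And>i. i < d \<Longrightarrow> v (\<Sum>n\<in>E. c n * of_int (falling_fact i (w n))) \<le> M" and "M \<ge> 0"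
  shows "v (\<Sum>n\<in>E. c n * of_int (g (w n))) \<le> M"
  using assms(1)
proof induction
  case (falling i)
  thus ?case using assms(2) by simp
next
  case (add g h)
  from v_add_le[OF add.IH] show ?case by (simp add: distrib_left sum.distrib)
next
  case (scale g k)
  have "(\<Sum>n\<in>E. c n * of_int (k * g (w n))) = of_int k * (\<Sum>n\<in>E. c n * of_int (g (w n)))"
    by (simp add: sum_distrib_left mult_ac)
  thus ?case using mult_mono[OF v_of_int_le[of k] scale.IH] by (simp add: v_mult)
qed (use assms(3) in simp)

text \<open>
  Let \<open>c\<^sub>k\<close> be the coefficients of \<open>f(r + rz)\<close>. On the set of exponents of \<open>f\<close> every falling
  factorial is an integral combination of the first \<open>t + 1\<close> ones, so \<open>|k! c\<^sub>k|\<close> is at most the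
  maximum of \<open>|c\<^sub>0|, \<dots>, |c\<^sub>t|\<close>. Since \<open>\<rho>\<^sup>k\<^sup>-\<^sup>t < |k!|\<close>, no coefficient beyond the \<open>t\<close>-th can dominate.
\<close>

lemma roots_in_coset_le_terms:
  assumes p: "p > e + t" and f: "f \<noteq> 0" and terms: "num_terms f \<le> t + 1"
    and S: "finite S" and r: "r \<noteq> 0" and near: "\<And>x. x \<in> S \<Longrightarrow> v (x - r) < v r"
  shows "(\<Sum>x\<in>S. order x f) \<le> t"
proof (rule coset_root_bound[OF f S r near])
  fix \<rho> :: real and k
  assume \<rho>: "\<rho> > 0" "\<rho> ^ e \<le> v (of_nat p)" and k: "k > t"
  define E where "E = {n. coeff f n \<noteq> 0}"
  define c where "c = coeff (f \<circ>\<^sub>p [:r, r:])"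
  define s where "s i = (\<Sum>n\<in>E. coeff f n * r ^ n * of_int (falling_fact i (int n)))" for i
  define d where "d = card E"
  have E: "finite E" unfolding E_def
    using MOST_coeff_eq_0[of f] by (simp add: eventually_cofinite)
  have d: "d \<le> t + 1" using terms by (simp add: d_def E_def num_terms_def)
  have s: "of_nat (fact i) * c i = s i" for i
    unfolding c_def s_def by (rule coeff_shift_scale[OF E]) (simp add: E_def)
  have s_le: "v (s i) \<le> v (c i)" for i
    unfolding s[symmetric] v_mult by (simp add: mult_left_le_one_le v_of_nat_le)
  have bound: "v (s j) \<le> M" if "\<And>i. i < d \<Longrightarrow> v (c i) \<le> M" "M \<ge> 0" for j M
  proof -
    obtain g where g: "g \<in> falling_span (card (int ` E))" "\<And>x. x \<in> E \<Longrightarrow> falling_fact j (int x) = g (int x)"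
      using falling_fact_on_finite[of "int ` E" j] E by auto
    have "card (int ` E) = d" by (simp add: d_def card_image)
    hence "v (\<Sum>n\<in>E. coeff f n * r ^ n * of_int (g (int n))) \<le> M"
      using g(1) that s_le unfolding s_def by (intro v_falling_span_sum[of g d]) (auto intro: order_trans)
    thus ?thesis using g(2) by (simp add: s_def)
  qed
  have "f \<circ>\<^sub>p [:r, r:] \<noteq> 0" using f r by (simp add: pcompose_eq_0_iff)
  then obtain j where j: "c j \<noteq> 0" unfolding c_def by (metis leading_coeff_0_iff)
  have "\<exists>i<d. c i \<noteq> 0"
  proof (rule ccontr)
    assume "\<not> ?thesis"
    hence "v (s j) \<le> 0" by (intro bound) auto
    moreover have "v (s j) = v (of_nat (fact j)) * v (c j)" by (simp flip: s add: v_mult)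
    ultimately show False using v_of_nat_pos[of "fact j"] v_pos[OF j] by (simp add: mult_le_0_iff)
  qed
  then obtain i1 where i1: "i1 < d" "c i1 \<noteq> 0" by blast
  define M where "M = Max ((\<lambda>i. v (c i)) ` {..<d})"
  have "M \<in> (\<lambda>i. v (c i)) ` {..<d}" unfolding M_def using i1 by (intro Max_in) auto
  then obtain i where i: "i < d" "M = v (c i)" by auto
  have M: "v (c i) \<le> M" if "i < d" for i unfolding M_def using that by (intro Max_ge) auto
  have Mpos: "M > 0" using M[OF i1(1)] v_pos[OF i1(2)] by linarith
  have \<rho>1: "\<rho> \<le> 1"
  proof (rule ccontr)
    assume "\<not> \<rho> \<le> 1"
    hence "1 \<le> \<rho> ^ e" by (intro one_le_power) auto
    thus False using \<rho> v_p_less_1 by linarith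
  qed
  have "v (of_nat (fact k)) * v (c k) \<le> M"
    using bound[OF M, of k] Mpos by (simp flip: s add: v_mult)
  hence "v (of_nat (fact k)) * (v (c k) * \<rho> ^ k) \<le> M * \<rho> ^ k"
    using mult_right_mono[of _ M "\<rho> ^ k"] \<rho> by (simp add: mult.assoc)
  also have "M * \<rho> ^ k \<le> M * (\<rho> ^ i * \<rho> ^ (k - t))"
    using \<rho> \<rho>1 i d k Mpos by (auto simp flip: power_add intro!: mult_left_mono power_decreasing)
  also have "M * (\<rho> ^ i * \<rho> ^ (k - t)) < M * \<rho> ^ i * v (of_nat (fact k))"
    using power_less_v_fact[OF p k _ \<rho>(2)] \<rho> Mpos by simp
  finally have "v (of_nat (fact k)) * (v (c k) * \<rho> ^ k) < v (of_nat (fact k)) * (v (c i) * \<rho> ^ i)"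
    using Mpos by (simp add: i(2) mult_ac)
  hence "v (c k) * \<rho> ^ k < v (c i) * \<rho> ^ i"
    using v_of_nat_pos[of "fact k"] by (simp add: mult_less_cancel_left)
  thus "\<exists>i\<le>t. v (coeff (f \<circ>\<^sub>p [:r, r:]) k) * \<rho> ^ k < v (coeff (f \<circ>\<^sub>p [:r, r:]) i) * \<rho> ^ i"
    using i d by (intro exI[of _ i]) (auto simp: c_def)
qed

text \<open>
  Here \<open>Q\<close> belongs to a term of maximal size on the coset, \<open>R\<close> to a smaller one, and the condition
  that \<open>r\<close> is a root eliminates \<open>P\<close>. What is left in \<open>k! c\<^sub>k\<close> are differences of falling factorials
  at \<open>m\<close> and \<open>l\<close> and at \<open>n\<close> and \<open>l\<close>. These are divisible by \<open>m - l\<close> and \<open>n - l\<close>, so under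
  \<open>exps\<close> their contributions are at most \<open>\<mu> = |Q r\<^sup>m| |m - l|\<close>, which is exactly the size of the
  linear coefficient.
\<close>

lemma edge_roots_in_coset_le_one:
  assumes p: "p > e + 1"
    and f: "f = monom P l + monom Q m + monom R n" "f \<noteq> 0"
    and distinct: "l \<noteq> m" "m \<noteq> n" "l \<noteq> n"
    and r: "r \<noteq> 0" "poly f r = 0" and small: "v (R * r ^ n) < v (Q * r ^ m)"
    and exps: "v (of_int (int n - int l)) \<le> v (of_int (int m - int l))"
    and S: "finite S" and near: "\<And>x. x \<in> S \<Longrightarrow> v (x - r) < v r"
  shows "(\<Sum>x\<in>S. order x f) \<le> 1"
proof (rule coset_root_bound[OF f(2) S r(1) near])
  fix \<rho> :: real and k :: nat
  assume \<rho>: "\<rho> > 0" "\<rho> ^ e \<le> v (of_nat p)" and k: "k > 1"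
  define c where "c = coeff (f \<circ>\<^sub>p [:r, r:])"
  define \<mu> where "\<mu> = v (Q * r ^ m) * v (of_int (int m - int l))"
  have "v (of_int (int m - int l)) > 0" using distinct by (intro v_of_int_pos) auto
  moreover have Qpos: "v (Q * r ^ m) > 0" using small v_nonneg[of "R * r ^ n"] by linarith
  ultimately have \<mu>: "\<mu> > 0" by (simp add: \<mu>_def)
  have root: "P * r ^ l = - (Q * r ^ m) - R * r ^ n"
    using r(2) unfolding f(1) by (simp add: poly_monom eq_neg_iff_add_eq_0 algebra_simps)
  have s: "of_nat (fact j) * c j = Q * r ^ m * of_int (falling_fact j (int m) - falling_fact j (int l))
       + R * r ^ n * of_int (falling_fact j (int n) - falling_fact j (int l))" for j
  proof -
    have "of_nat (fact j) * c j = (\<Sum>i\<in>{l,m,n}. coeff f i * r ^ i * of_int (falling_fact j (int i)))"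
      unfolding c_def by (rule coeff_shift_scale) (auto simp: f(1) split: if_splits)
    also have "\<dots> = P * r ^ l * of_int (falling_fact j (int l)) + Q * r ^ m * of_int (falling_fact j (int m))
       + R * r ^ n * of_int (falling_fact j (int n))"
      using distinct by (simp add: f(1) add_ac)
    finally show ?thesis unfolding root by (simp add: algebra_simps)
  qed
  have c1: "v (c 1) = \<mu>"
  proof -
    have "c 1 = Q * r ^ m * of_int (int m - int l) + R * r ^ n * of_int (int n - int l)"
      using s[of 1] by (simp add: falling_fact_def)
    moreover have "v (R * r ^ n * of_int (int n - int l)) < v (Q * r ^ m * of_int (int m - int l))"
    proof -
      have "v (R * r ^ n) * v (of_int (int n - int l)) \<le> v (R * r ^ n) * v (of_int (int m - int l))"
        using exps by (intro mult_left_mono) auto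
      also have "\<dots> < \<mu>" using small \<open>v (of_int (int m - int l)) > 0\<close> by (simp add: \<mu>_def)
      finally show ?thesis by (simp only: v_mult[of "R * r ^ n"] v_mult[of "Q * r ^ m"] \<mu>_def)
    qed
    ultimately show ?thesis by (simp only: v_add_dominant v_mult[of "Q * r ^ m"] \<mu>_def)
  qed
  have diff: "v (of_int (falling_fact j (int i) - falling_fact j (int l))) \<le> v (of_int (int i - int l))" for i j
  proof -
    obtain z where "falling_fact j (int i) - falling_fact j (int l) = (int i - int l) * z"
      using falling_fact_diff_dvd by (metis dvdE)
    thus ?thesis
      using mult_left_mono[OF v_of_int_le[of z], of "v (of_int (int i - int l))"]
      by (simp only: of_int_mult v_mult) simp
  qed
  have "v (of_nat (fact k) * c k) \<le> \<mu>"
    unfolding s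
  proof (rule v_add_le)
    show "v (Q * r ^ m * of_int (falling_fact k (int m) - falling_fact k (int l))) \<le> \<mu>"
      unfolding \<mu>_def v_mult[of "Q * r ^ m"] by (intro mult_left_mono diff) auto
    show "v (R * r ^ n * of_int (falling_fact k (int n) - falling_fact k (int l))) \<le> \<mu>"
      unfolding \<mu>_def v_mult[of "R * r ^ n"]
      by (intro mult_mono order_trans[OF diff exps]) (use small in auto)
  qed
  hence "v (of_nat (fact k)) * (v (c k) * \<rho> ^ k) \<le> \<mu> * \<rho> ^ k"
    using mult_right_mono[of _ \<mu> "\<rho> ^ k"] \<rho> by (simp add: mult.assoc v_mult)
  also have "\<mu> * \<rho> ^ k = \<mu> * (\<rho> * \<rho> ^ (k - 1))" using k by (cases k) auto
  also have "\<mu> * (\<rho> * \<rho> ^ (k - 1)) < \<mu> * (\<rho> * v (of_nat (fact k)))"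
    using power_less_v_fact[OF p k _ \<rho>(2)] \<rho> \<mu> by simp
  finally have "v (of_nat (fact k)) * (v (c k) * \<rho> ^ k) < v (of_nat (fact k)) * (v (c 1) * \<rho> ^ 1)"
    by (simp add: c1[unfolded One_nat_def] mult_ac)
  hence "v (c k) * \<rho> ^ k < v (c 1) * \<rho> ^ 1"
    using v_of_nat_pos[of "fact k"] by (simp add: mult_less_cancel_left)
  thus "\<exists>i\<le>1. v (coeff (f \<circ>\<^sub>p [:r, r:]) k) * \<rho> ^ k < v (coeff (f \<circ>\<^sub>p [:r, r:]) i) * \<rho> ^ i"
    by (auto simp: c_def)
qed

end

section \<open>Counting the roots of trinomials\<close>

lemma trinomial_of_num_terms_le_3:
  fixes f :: "'a::comm_monoid_add poly"
  assumes "num_terms f \<le> 3"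
  obtains A B C l m n where "f = monom A l + monom B m + monom C n" "l < m" "m < n"
proof -
  define E where "E = {i. coeff f i \<noteq> 0}"
  have E: "finite E" "card E \<le> 3"
    using MOST_coeff_eq_0[of f] assms by (auto simp: E_def num_terms_def eventually_cofinite)
  \<comment> \<open>Exponents with coefficient \<open>0\<close> fill the support up to three elements.\<close>
  obtain k where k: "\<And>i. i \<in> E \<Longrightarrow> i < k" using E(1) finite_nat_bounded[of E] by auto
  define E' where "E' = E \<union> {k..<k + (3 - card E)}"
  have "card E' = 3"
  proof -
    have "card E' = card E + card {k..<k + (3 - card E)}"
      unfolding E'_def using E(1) k by (intro card_Un_disjoint) force+
    thus ?thesis using E(2) by simp
  qed
  then obtain x y z where xyz: "E' = {x, y, z}" "x \<noteq> y" "y \<noteq> z" "x \<noteq> z"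
    by (auto simp: card_3_iff)
  have "\<exists>l m n. E' = {l, m, n} \<and> l < m \<and> m < n"
  proof -
    consider "x < y \<and> y < z" | "x < z \<and> z < y" | "y < x \<and> x < z" | "y < z \<and> z < x" | "z < x \<and> x < y" | "z < y \<and> y < x"
      using xyz by linarith
    thus ?thesis by cases (use xyz(1) in \<open>blast+\<close>)
  qed
  then obtain l m n where lmn: "E' = {l, m, n}" "l < m" "m < n" by blast
  have "f = monom (coeff f l) l + monom (coeff f m) m + monom (coeff f n) n"
  proof (rule poly_eqI)
    fix i
    have "coeff f i = 0" if "i \<noteq> l" "i \<noteq> m" "i \<noteq> n"
      using that lmn(1) by (auto simp: E'_def E_def)
    thus "coeff f i = coeff (monom (coeff f l) l + monom (coeff f m) m + monom (coeff f n) n) i"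
      using lmn(2,3) by auto
  qed
  thus ?thesis using that lmn by blast
qed

text \<open>
  The residue field is represented by systems of units that are pairwise incongruent modulo the
  maximal ideal: \<open>q - 1\<close> is their largest size, and a system of this size can be chosen whose members
  satisfy Fermat's congruence.
\<close>

locale local_field = low_ramification v p e for v :: "'k::field \<Rightarrow> real" and p e +
  fixes q :: nat
  assumes q_ge_2: "q \<ge> 2"
    and v_q_less_1: "v (of_nat q) < 1"
    and residues_le: "finite T \<Longrightarrow> (\<And>x. x \<in> T \<Longrightarrow> v x = 1) \<Longrightarrow>
      (\<And>x y. x \<in> T \<Longrightarrow> y \<in> T \<Longrightarrow> x \<noteq> y \<Longrightarrow> v (x - y) \<ge> 1) \<Longrightarrow> card T \<le> q - 1"
    and residues_exist: "\<exists>T. finite T \<and> card T = q - 1 \<and> (\<forall>x\<in>T. v x = 1 \<and> v (x ^ (q - 1) - 1) < 1) \<and>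
      (\<forall>x\<in>T. \<forall>y\<in>T. x \<noteq> y \<longrightarrow> v (x - y) \<ge> 1)"
    and complete: "v_complete v"
begin

lemma sum_over_shell_le:
  fixes w :: "'k \<Rightarrow> nat"
  assumes S: "finite S" and s: "s > 0" "\<And>x. x \<in> S \<Longrightarrow> v x = s"
    and coset: "\<And>r. r \<in> S \<Longrightarrow> (\<Sum>x | x \<in> S \<and> v (x - r) < s. w x) \<le> t"
  shows "sum w S \<le> t * (q - 1)"
proof (cases "S = {}")
  case False
  then obtain x0 where x0: "x0 \<in> S" by blast
  define c where "c x = {y \<in> S. v (y - x) < s}" for x
  define T where "T = inv_into S c ` (c ` S)"
  have self: "x \<in> c x" if "x \<in> S" for x using that s(1) by (simp add: c_def)
  have c_eq: "c x = c y" if "v (x - y) < s" for x y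
  proof -
    have "v (z - x) < s \<longleftrightarrow> v (z - y) < s" for z
      using v_add_less[of "z - x" s "x - y"] v_diff_less[of "z - y" s "x - y"] that by auto
    thus ?thesis by (simp add: c_def)
  qed
  have TS: "T \<subseteq> S" unfolding T_def by (auto intro: inv_into_into)
  have cardT: "card T = card (c ` S)" unfolding T_def
    by (intro card_image inj_on_inv_into) auto
  have sep: "v (x - y) \<ge> s" if "x \<in> T" "y \<in> T" "x \<noteq> y" for x y
  proof (rule ccontr)
    assume "\<not> ?thesis"
    hence "c x = c y" by (intro c_eq) simp
    moreover have "inv_into S c (c z) = z" if "z \<in> T" for z
      using that unfolding T_def by (auto simp: f_inv_into_f)
    ultimately show False using that by metis
  qed
  have vx0: "v x0 = s" using s x0 by simp
  hence nz: "x0 \<noteq> 0" using s(1) by auto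
  have "card T = card ((\<lambda>x. x / x0) ` T)" using nz by (intro card_image[symmetric]) (auto simp: inj_on_def)
  also have "\<dots> \<le> q - 1"
  proof (rule residues_le)
    show "finite ((\<lambda>x. x / x0) ` T)" using S TS finite_subset by blast
    show "v x = 1" if "x \<in> (\<lambda>x. x / x0) ` T" for x
      using that TS s(2) nz vx0 by (fastforce simp: v_divide)
    show "v (x - y) \<ge> 1" if xy: "x \<in> (\<lambda>x. x / x0) ` T" "y \<in> (\<lambda>x. x / x0) ` T" "x \<noteq> y" for x y
    proof -
      obtain x' y' where "x' \<in> T" "y' \<in> T" "x = x' / x0" "y = y' / x0" "x' \<noteq> y'"
        using xy by blast
      thus ?thesis using sep[of x' y'] s(1) vx0 by (simp add: v_divide flip: diff_divide_distrib)
    qed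
  qed
  finally have card: "card (c ` S) \<le> q - 1" by (simp add: cardT)
  have "sum w S = (\<Sum>C\<in>c ` S. sum w {x \<in> S. c x = C})"
    by (rule sum.image_gen[OF S])
  also have "\<dots> \<le> (\<Sum>C\<in>c ` S. t)"
  proof (rule sum_mono)
    fix C assume "C \<in> c ` S"
    then obtain r where r: "r \<in> S" "C = c r" by blast
    have "sum w {x \<in> S. c x = C} \<le> (\<Sum>x | x \<in> S \<and> v (x - r) < s. w x)"
    proof (rule sum_mono2)
      show "{x \<in> S. c x = C} \<subseteq> {x \<in> S. v (x - r) < s}"
        using self r unfolding c_def by auto
    qed (use S in auto)
    also have "\<dots> \<le> t" by (rule coset[OF r(1)])
    finally show "sum w {x \<in> S. c x = C} \<le> t" .
  qed
  also have "\<dots> \<le> t * (q - 1)" using card by simp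
  finally show ?thesis .
qed simp

text \<open>
  For a root \<open>x\<close> the ultrametric inequality forces the maximum of the three term sizes \<open>\<alpha> x\<close>,
  \<open>\<beta> x\<close>, \<open>\<gamma> x\<close> to be attained twice. If the outer terms dominate at one root, convexity of the Newton
  polygon gives all roots the same absolute value. Otherwise the roots lie on the two shells \<open>R1\<close>
  and \<open>R2\<close>, given by the edges from \<open>l\<close> to \<open>m\<close> and from \<open>m\<close> to \<open>n\<close>, and the edge of larger
  \<open>p\<close>-adic length contributes one root per coset.
\<close>

lemma trinomial_roots_le:
  fixes f :: "'k poly"
  assumes p: "p > 2 + e" and f: "f \<noteq> 0" "num_terms f \<le> 3"
  shows "num_nonzero_roots f \<le> 3 * (q - 1)"
proof -
  obtain A B C l m n where f_eq: "f = monom A l + monom B m + monom C n" and lmn: "l < m" "m < n"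
    by (rule trinomial_of_num_terms_le_3[OF f(2)])
  define R where "R = {x. x \<noteq> 0 \<and> poly f x = 0}"
  have R: "finite R" unfolding R_def by (rule finite_subset[OF _ poly_roots_finite[OF f(1)]]) auto
  have eval: "A * x ^ l + B * x ^ m + C * x ^ n = 0" if "x \<in> R" for x
    using that by (simp add: R_def f_eq poly_monom)
  have nz: "x \<noteq> 0" "v x > 0" if "x \<in> R" for x using that v_pos by (auto simp: R_def)
  define \<alpha> where "\<alpha> x = v A * v x ^ l" for x
  define \<beta> where "\<beta> x = v B * v x ^ m" for x
  define \<gamma> where "\<gamma> x = v C * v x ^ n" for x
  have abg: "v (A * x ^ l) = \<alpha> x" "v (B * x ^ m) = \<beta> x" "v (C * x ^ n) = \<gamma> x" for x
    by (simp_all add: \<alpha>_def \<beta>_def \<gamma>_def v_mult v_power)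
  have two: "sum (\<lambda>x. order x f) S \<le> 2 * (q - 1)"
    if S: "S \<subseteq> R" and s: "\<And>x y. x \<in> S \<Longrightarrow> y \<in> S \<Longrightarrow> v x = v y" for S
  proof (cases "S = {}")
    case False
    then obtain x0 where x0: "x0 \<in> S" by blast
    show ?thesis
    proof (rule sum_over_shell_le[where s = "v x0"])
      fix r assume r: "r \<in> S"
      show "(\<Sum>x | x \<in> S \<and> v (x - r) < v x0. order x f) \<le> 2"
      proof (rule roots_in_coset_le_terms[where r = r])
        show "finite {x \<in> S. v (x - r) < v x0}" using finite_subset[OF S R] by simp
        show "r \<noteq> 0" using nz(1) r S by blast
        show "v (x - r) < v r" if "x \<in> {x \<in> S. v (x - r) < v x0}" for x
          using that unfolding s[OF x0 r] by simp
      qed (use p f in simp_all)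
    next
      show "finite S" by (rule finite_subset[OF S R])
      show "v x0 > 0" using nz(2) x0 S by blast
      show "v x = v x0" if "x \<in> S" for x by (rule s[OF that x0])
    qed
  qed simp
  have dominant: "(\<alpha> x = \<gamma> x \<and> \<beta> x \<le> \<alpha> x) \<or> (\<alpha> x = \<beta> x \<and> \<gamma> x < \<beta> x) \<or> (\<gamma> x = \<beta> x \<and> \<alpha> x < \<beta> x)"
    if "x \<in> R" for x
  proof -
    note ev = eval[OF that]
    have "A * x ^ l = - (B * x ^ m + C * x ^ n)" "B * x ^ m = - (A * x ^ l + C * x ^ n)"
        "C * x ^ n = - (A * x ^ l + B * x ^ m)"
      using ev by (simp_all add: eq_neg_iff_add_eq_0 algebra_simps)
    hence "\<alpha> x \<le> max (\<beta> x) (\<gamma> x)" "\<beta> x \<le> max (\<alpha> x) (\<gamma> x)" "\<gamma> x \<le> max (\<alpha> x) (\<beta> x)"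
      unfolding abg[symmetric] by (metis v_minus v_add)+
    thus ?thesis by linarith
  qed
  have same: "v x = v y" if xy: "x \<in> R" "y \<in> R" and eq: "a * v x ^ i = b * v x ^ j" "a * v y ^ i = b * v y ^ j"
      and "a > 0" "i < j" for x y a b i j
  proof -
    have "v z ^ (j - i) = a / b" if "z \<in> R" "a * v z ^ i = b * v z ^ j" for z
    proof -
      have "v z ^ j = v z ^ i * v z ^ (j - i)" using \<open>i < j\<close> by (simp flip: power_add)
      hence "v z ^ i * a = v z ^ i * (b * v z ^ (j - i))" using that(2) by (simp add: mult_ac)
      hence "a = b * v z ^ (j - i)" using nz[OF that(1)] by simp
      thus ?thesis using \<open>a > 0\<close> by (auto simp: field_simps)
    qed
    from this[OF xy(1) eq(1)] this[OF xy(2) eq(2)] have "v x ^ (j - i) = v y ^ (j - i)" by simp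
    thus ?thesis using \<open>i < j\<close> by (simp add: power_eq_iff_eq_base)
  qed
  show ?thesis
  proof (cases "\<exists>x0\<in>R. \<alpha> x0 = \<gamma> x0 \<and> \<beta> x0 \<le> \<alpha> x0")
    case True
    then obtain x0 where x0: "x0 \<in> R" "\<alpha> x0 = \<gamma> x0" "\<beta> x0 \<le> \<alpha> x0" by blast
    have Apos: "v A > 0"
    proof (rule ccontr)
      assume "\<not> v A > 0"
      hence "A = 0" by (metis v_pos)
      hence "\<alpha> x0 = 0" by (simp add: \<alpha>_def)
      moreover have "\<beta> x0 \<ge> 0" by (simp add: \<beta>_def)
      ultimately have "\<beta> x0 = 0" "\<gamma> x0 = 0" using x0 by linarith+
      hence "B = 0" "C = 0" using nz[OF x0(1)] by (auto simp: \<beta>_def \<gamma>_def)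
      thus False using \<open>A = 0\<close> f(1) f_eq by simp
    qed
    have "v x = v x0" if x: "x \<in> R" for x
    proof -
      define u where "u = v x / v x0"
      have u: "v x = u * v x0" "u > 0" using nz[OF x] nz[OF x0(1)] by (simp_all add: u_def)
      define M where "M = \<alpha> x0"
      have M: "M > 0" using Apos nz[OF x0(1)] by (simp add: M_def \<alpha>_def)
      have ax: "\<alpha> x = M * u ^ l" "\<gamma> x = M * u ^ n" "\<beta> x \<le> M * u ^ m"
      proof -
        show "\<alpha> x = M * u ^ l" by (simp add: M_def \<alpha>_def u(1) power_mult_distrib mult_ac)
        have "\<gamma> x = \<gamma> x0 * u ^ n" by (simp add: \<gamma>_def u(1) power_mult_distrib mult_ac)
        thus "\<gamma> x = M * u ^ n" using x0 by (simp add: M_def)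
        have "\<beta> x = \<beta> x0 * u ^ m" by (simp add: \<beta>_def u(1) power_mult_distrib mult_ac)
        thus "\<beta> x \<le> M * u ^ m" using x0 u(2) by (simp add: M_def)
      qed
      \<comment> \<open>Moving away from \<open>v x0\<close> makes a single outer term strictly dominant.\<close>
      have "u = 1"
      proof (rule ccontr)
        assume "u \<noteq> 1"
        then consider "u < 1" | "u > 1" by linarith
        thus False
        proof cases
          case 1
          hence "M * u ^ n < M * u ^ l" "M * u ^ m < M * u ^ l"
            using lmn u M by (auto intro!: mult_strict_left_mono power_strict_decreasing)
          thus False using dominant[OF x] ax by linarith
        next
          case 2
          hence "M * u ^ l < M * u ^ n" "M * u ^ m < M * u ^ n"
            using lmn u M by (auto intro!: mult_strict_left_mono power_strict_increasing)
          thus False using dominant[OF x] ax by linarith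
        qed
      qed
      thus ?thesis using u by simp
    qed
    hence "sum (\<lambda>x. order x f) R \<le> 2 * (q - 1)" by (intro two) auto
    thus ?thesis by (simp add: num_nonzero_roots_def R_def)
  next
    case False
    define R1 where "R1 = {x \<in> R. \<alpha> x = \<beta> x \<and> \<gamma> x < \<beta> x}"
    define R2 where "R2 = {x \<in> R. \<gamma> x = \<beta> x \<and> \<alpha> x < \<beta> x}"
    have "x \<in> R1 \<union> R2" if "x \<in> R" for x
      using dominant[OF that] False that unfolding R1_def R2_def by blast
    hence R12: "R = R1 \<union> R2" "R1 \<inter> R2 = {}" "finite R1" "finite R2"
      using R by (auto simp: R1_def R2_def)
    have s1: "v x = v y" if "x \<in> R1" "y \<in> R1" for x y
    proof (rule same[of x y "v A" l "v B" m])
      have "0 < \<beta> x" using that v_nonneg[of C] nz[of x] by (auto simp: R1_def \<gamma>_def intro: le_less_trans[rotated])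
      hence "0 < \<alpha> x" using that by (simp add: R1_def)
      thus "v A > 0" using nz[of x] that by (auto simp: \<alpha>_def R1_def zero_less_mult_iff)
    qed (use that lmn in \<open>auto simp: R1_def \<alpha>_def \<beta>_def\<close>)
    have s2: "v x = v y" if "x \<in> R2" "y \<in> R2" for x y
    proof (rule same[of x y "v B" m "v C" n])
      have "0 < \<beta> x" using that v_nonneg[of A] nz[of x] by (auto simp: R2_def \<alpha>_def intro: le_less_trans[rotated])
      thus "v B > 0" using nz[of x] that by (auto simp: \<beta>_def R2_def zero_less_mult_iff)
    qed (use that lmn in \<open>auto simp: R2_def \<gamma>_def \<beta>_def\<close>)
    have one: "sum (\<lambda>x. order x f) S \<le> 1 * (q - 1)"
      if S: "S \<subseteq> R" and s: "\<And>x y. x \<in> S \<Longrightarrow> y \<in> S \<Longrightarrow> v x = v y"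
        and eqs: "f = monom P i + monom Q j + monom T k" "i \<noteq> j" "j \<noteq> k" "i \<noteq> k"
        and small: "\<And>x. x \<in> S \<Longrightarrow> v (T * x ^ k) < v (Q * x ^ j)"
        and exps: "v (of_int (int k - int i)) \<le> v (of_int (int j - int i))"
      for S P Q T i j k
    proof (cases "S = {}")
      case False
      then obtain x0 where x0: "x0 \<in> S" by blast
      show ?thesis
      proof (rule sum_over_shell_le[where s = "v x0"])
        fix r assume r: "r \<in> S"
        hence r': "r \<noteq> 0" "poly f r = 0" using S by (auto simp: R_def)
        show "(\<Sum>x | x \<in> S \<and> v (x - r) < v x0. order x f) \<le> 1"
        proof (rule edge_roots_in_coset_le_one[OF _ eqs(1) f(1) eqs(2-4) r' small[OF r] exps])
          show "finite {x \<in> S. v (x - r) < v x0}" using finite_subset[OF S R] by simp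
          show "v (x - r) < v r" if "x \<in> {x \<in> S. v (x - r) < v x0}" for x
            using that unfolding s[OF x0 r] by simp
        qed (use p in simp)
      next
        show "finite S" by (rule finite_subset[OF S R])
        show "v x0 > 0" using nz(2) x0 S by blast
        show "v x = v x0" if "x \<in> S" for x by (rule s[OF that x0])
      qed
    qed simp
    have split: "num_nonzero_roots f = sum (\<lambda>x. order x f) R1 + sum (\<lambda>x. order x f) R2"
      unfolding num_nonzero_roots_def R_def[symmetric] R12(1)
      by (rule sum.union_disjoint) (use R12 in auto)
    \<comment> \<open>The \<open>p\<close>-adic lengths of the two edges, whose sum is the third difference of exponents.\<close>
    define d1 where "d1 = v (of_int (int m - int l))"
    define d2 where "d2 = v (of_int (int m - int n))"
    have nl: "v (of_int (int n - int l)) \<le> max d1 d2"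
    proof -
      have "(of_int (int n - int l) :: 'k) = of_int (int m - int l) - of_int (int m - int n)" by simp
      thus ?thesis unfolding d1_def d2_def by (metis v_diff)
    qed
    show ?thesis
    proof (cases "d2 \<le> d1")
      case True
      have "sum (\<lambda>x. order x f) R1 \<le> 1 * (q - 1)"
        by (rule one[OF _ s1 f_eq])
           (use lmn nl True in \<open>auto simp: R1_def abg d1_def\<close>)
      moreover have "sum (\<lambda>x. order x f) R2 \<le> 2 * (q - 1)"
        by (rule two[OF _ s2]) (auto simp: R2_def)
      ultimately show ?thesis unfolding split by linarith
    next
      case False
      have "v (of_int (int l - int n)) \<le> d2"
      proof -
        have "(of_int (int l - int n) :: 'k) = - of_int (int n - int l)" by simp
        thus ?thesis using nl False by (simp only: v_minus)
      qed
      hence "sum (\<lambda>x. order x f) R2 \<le> 1 * (q - 1)"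
        by (intro one[where P = C and i = n and Q = B and j = m and T = A and k = l, OF _ s2])
           (use lmn in \<open>auto simp: R2_def abg d2_def f_eq\<close>)
      moreover have "sum (\<lambda>x. order x f) R1 \<le> 2 * (q - 1)"
        by (rule two[OF _ s1]) (auto simp: R1_def)
      ultimately show ?thesis unfolding split by linarith
    qed
  qed
qed

lemma v_power_minus_one: "v (x - 1) < 1 \<Longrightarrow> v (x ^ n - 1) < 1"
proof (induction n)
  case (Suc n)
  have x: "v x = 1" using v_eq_of_diff_less[of x 1] Suc by simp
  have "x ^ Suc n - 1 = x * (x ^ n - 1) + (x - 1)" by (simp add: algebra_simps)
  moreover have "v (x * (x ^ n - 1)) < 1" using Suc x by (simp add: v_mult)
  ultimately show ?case using Suc.prems by (simp only: v_add_less)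
qed simp

text \<open>
  Lifted roots stay in the residue classes of the approximate roots, so no two of them coincide.
\<close>

lemma hensel_residues:
  assumes h: "\<And>i. v (coeff h i) \<le> 1"
    and T: "finite T" "\<And>x. x \<in> T \<Longrightarrow> v x = 1" "\<And>x y. x \<in> T \<Longrightarrow> y \<in> T \<Longrightarrow> x \<noteq> y \<Longrightarrow> v (x - y) \<ge> 1"
    and root: "\<And>x. x \<in> T \<Longrightarrow> v (poly h x) < 1" and simple: "\<And>x. x \<in> T \<Longrightarrow> v (poly (pderiv h) x) = 1"
  obtains Y where "finite Y" "card Y = card T" "\<And>y. y \<in> Y \<Longrightarrow> v y = 1 \<and> poly h y = 0"
proof -
  have "\<exists>y. poly h y = 0 \<and> v (y - x) < 1" if "x \<in> T" for x
    using hensel[OF complete h _ root[OF that] simple[OF that]] T(2)[OF that] by auto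
  then obtain g where g: "\<And>x. x \<in> T \<Longrightarrow> poly h (g x) = 0 \<and> v (g x - x) < 1" by metis
  have "inj_on g T"
  proof (rule inj_onI, rule ccontr)
    fix x y assume xy: "x \<in> T" "y \<in> T" "g x = g y" "x \<noteq> y"
    have "v ((g x - x) - (g y - y)) < 1" using g xy(1,2) by (intro v_diff_less[of "g x - x" _ "g y - y"]) auto
    hence "v (y - x) < 1" using xy by simp
    thus False using T(3)[of y x] xy by auto
  qed
  moreover have "v (g x) = 1" if "x \<in> T" for x
    using v_eq_of_diff_less[of "g x" x] g[OF that] T(2)[OF that] by simp
  ultimately show ?thesis
    using g T(1) by (intro that[of "g ` T"]) (auto simp: card_image)
qed

text \<open>
  In terms of \<open>y = x\<^sup>q\<^sup>-\<^sup>1\<close> this is \<open>1 - (1 + a)y\<^sup>a + a y\<^sup>a\<^sup>+\<^sup>1\<close>, the trinomial with a double zero at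
  \<open>1\<close>.
\<close>

definition extremal_trinomial :: "nat \<Rightarrow> 'k poly" where
  "extremal_trinomial a =
     monom 1 0 + monom (- of_nat (a + 1)) (a * (q - 1)) + monom (of_nat a) ((a + 1) * (q - 1))"

text \<open>
  The choice of \<open>a\<close> serves two purposes: \<open>a\<close> is divisible by \<open>p\<close>, which separates the third zero from
  the double one, and \<open>a\<close> is a \<open>(q-1)\<close>-st power, so that this zero pulls back to \<open>K\<close>.
\<close>

lemma extremal_trinomial_roots:
  assumes a: "a = p ^ (q - 1)"
  shows "extremal_trinomial a \<noteq> 0" "num_terms (extremal_trinomial a) \<le> 3"
    "num_nonzero_roots (extremal_trinomial a) \<ge> 3 * (q - 1)"
proof -
  define N where "N = q - 1"
  define f where "f = extremal_trinomial a"
  have f: "f = monom 1 0 + monom (- of_nat (a + 1)) (a * N) + monom (of_nat a) ((a + 1) * N)"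
    by (simp add: f_def extremal_trinomial_def N_def)
  have N: "N > 0" using q_ge_2 by (simp add: N_def)
  have apos: "a > 0" using prime_p prime_gt_0_nat by (simp add: a)
  have va: "v (of_nat a) < 1"
    using power_Suc_less_one[of "v (of_nat p)"] N v_p_less_1 v_p_pos
    unfolding a N_def[symmetric] of_nat_power v_power by (intro power_less_one_iff[THEN iffD2]) auto
  have va1: "v (of_nat (a + 1)) = 1"
    using v_add_dominant[of "of_nat a" 1] va by (simp add: add.commute)
  have vN: "v (of_nat N) = 1"
  proof -
    have "(of_nat N :: 'k) = -1 + of_nat q" using q_ge_2 by (simp add: N_def of_nat_diff)
    thus ?thesis using v_add_dominant[of "of_nat q" "-1"] v_q_less_1 by simp
  qed
  obtain T where T: "finite T" "card T = N" "\<And>x. x \<in> T \<Longrightarrow> v x = 1" "\<And>x. x \<in> T \<Longrightarrow> v (x ^ N - 1) < 1"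
      "\<And>x y. x \<in> T \<Longrightarrow> y \<in> T \<Longrightarrow> x \<noteq> y \<Longrightarrow> v (x - y) \<ge> 1"
    using residues_exist unfolding N_def[symmetric] by blast
  have coeff0: "coeff f 0 = 1" using N apos by (simp add: f)
  show f0: "extremal_trinomial a \<noteq> 0" using coeff0 unfolding f_def by auto
  have "{i. coeff f i \<noteq> 0} \<subseteq> {0, a * N, (a + 1) * N}" by (auto simp: f split: if_splits)
  hence "num_terms f \<le> card {0, a * N, (a + 1) * N}" unfolding num_terms_def by (intro card_mono) auto
  also have "\<dots> \<le> 3" by (simp add: card_insert_if)
  finally show "num_terms (extremal_trinomial a) \<le> 3" by (simp add: f_def)

  \<comment> \<open>The double roots: the \<open>(q-1)\<close>-st roots of unity.\<close>
  obtain Z where Z: "finite Z" "card Z = N" "\<And>z. z \<in> Z \<Longrightarrow> v z = 1 \<and> z ^ N = 1"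
  proof (rule hensel_residues[where h = "monom 1 N - 1" and T = T])
    show "v (coeff (monom 1 N - 1) i) \<le> 1" for i
      unfolding coeff_diff by (intro v_diff_le) auto
    show "v (poly (monom 1 N - 1) x) < 1" if "x \<in> T" for x using T(4)[OF that] by (simp add: poly_monom)
    show "v (poly (pderiv (monom 1 N - 1)) x) = 1" if "x \<in> T" for x
      using T(3)[OF that] vN by (simp add: pderiv_diff pderiv_monom poly_monom v_mult v_power)
  qed (use T in \<open>auto simp: poly_monom\<close>)

  \<comment> \<open>\<open>h(x) = a\<^sup>a f(x/p)\<close>; modulo the maximal ideal it is \<open>Y\<^sup>a (Y - 1)\<close> with \<open>Y = x\<^sup>q\<^sup>-\<^sup>1\<close>, so every
    non-zero residue is a simple root.\<close>
  define h :: "'k poly" where "h = monom 1 ((a + 1) * N) - monom (of_nat (a + 1)) (a * N) + monom (of_nat a ^ a) 0"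
  obtain Y where Y: "finite Y" "card Y = N" "\<And>y. y \<in> Y \<Longrightarrow> v y = 1 \<and> poly h y = 0"
  proof (rule hensel_residues[where h = h and T = T])
    show "v (coeff h i) \<le> 1" for i
    proof -
      have "v (of_nat a ^ a) \<le> 1" using v_of_nat_le[of "a ^ a"] by simp
      thus ?thesis unfolding h_def coeff_add coeff_diff
        using v_of_nat_le[of "a + 1"] by (intro v_add_le v_diff_le) auto
    qed
    fix x assume x: "x \<in> T"
    have pow: "v (x ^ (k * N) - 1) < 1" for k
      using v_power_minus_one[OF T(4)[OF x], of k] by (simp add: mult.commute flip: power_mult)
    have "poly h x = (x ^ ((a + 1) * N) - 1) - (x ^ (a * N) - 1) - of_nat a * x ^ (a * N) + of_nat a ^ a"
      by (simp add: h_def poly_monom algebra_simps)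
    moreover have "v (of_nat a * x ^ (a * N)) < 1" using T(3)[OF x] va by (simp add: v_mult v_power)
    moreover have "v (of_nat a ^ a) < 1" using va apos by (simp add: v_power power_less_one_iff)
    ultimately show "v (poly h x) < 1" by (simp only:) (intro v_add_less v_diff_less pow)
    have "poly (pderiv h) x = of_nat (a + 1) * of_nat N * x ^ ((a + 1) * N - 1)
       + - (of_nat (a + 1) * of_nat a * of_nat N * x ^ (a * N - 1))"
      by (simp add: h_def pderiv_add pderiv_diff pderiv_monom poly_monom algebra_simps)
    moreover have "v (of_nat (a + 1) * of_nat N * x ^ ((a + 1) * N - 1)) = 1"
      using va1 vN T(3)[OF x] by (simp only: v_mult v_power) simp
    moreover have "v (- (of_nat (a + 1) * of_nat a * of_nat N * x ^ (a * N - 1))) < 1"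
      using va1 vN T(3)[OF x] va by (simp only: v_minus v_mult v_power) simp
    ultimately show "v (poly (pderiv h) x) = 1" by (simp only: v_add_dominant)
  qed (use T in auto)

  define X where "X = (\<lambda>y. y / of_nat p) ` Y"
  have pnz: "(of_nat p :: 'k) \<noteq> 0" using v_p_pos by auto
  hence anz: "(of_nat a :: 'k) \<noteq> 0" by (simp add: a)
  have X: "finite X" "card X = N"
    using Y pnz by (auto simp: X_def card_image inj_on_def)
  have Xroot: "poly f x = 0 \<and> v x > 1" if x: "x \<in> X" for x
  proof -
    obtain y where y: "y \<in> Y" "x = y / of_nat p" using x by (auto simp: X_def)
    have pow: "x ^ (k * N) = y ^ (k * N) / of_nat a ^ k" for k
      by (simp add: y(2) power_divide a N_def flip: power_mult) (simp add: mult.commute)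
    have "of_nat a ^ a * poly f x = poly h y"
      using anz unfolding f h_def poly_add poly_diff poly_monom pow
      by (simp add: field_simps)
    hence "poly f x = 0" using Y(3)[OF y(1)] anz by simp
    moreover have "v x > 1" using Y(3)[OF y(1)] v_p_pos v_p_less_1 by (simp add: y(2) v_divide)
    ultimately show ?thesis by simp
  qed
  have f0': "f \<noteq> 0" using f0 by (simp add: f_def)
  have Xord: "order x f \<ge> 1" if "x \<in> X" for x
    using Xroot[OF that] f0' by (simp add: order_root Suc_le_eq)
  have Zord: "order z f \<ge> 2" if z: "z \<in> Z" for z
  proof -
    have zN: "z ^ (k * N) = 1" for k using Z(3)[OF z] by (simp add: mult.commute power_mult)
    have root: "poly f z = 0" unfolding f poly_add poly_monom zN by simp
    have "poly (pderiv f) z = of_nat (a * (a + 1) * N) * (z ^ ((a + 1) * N - 1) - z ^ (a * N - 1))"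
      by (simp add: f pderiv_add pderiv_monom poly_monom algebra_simps)
    also have "(a + 1) * N - 1 = N + (a * N - 1)" using N apos by simp
    also have "z ^ (N + (a * N - 1)) = z ^ (a * N - 1)" using Z(3)[OF z] by (simp add: power_add)
    finally have der: "poly (pderiv f) z = 0" by simp
    obtain g where g: "f = [:-z, 1:] * g" using root by (auto simp: poly_eq_0_iff_dvd)
    have "poly g z = 0"
    proof -
      have "pderiv f = [:-z, 1:] * pderiv g + g * pderiv [:-z, 1:]" unfolding g by (rule pderiv_mult)
      thus ?thesis using der by (simp add: pderiv_pCons)
    qed
    then obtain g' where "g = [:-z, 1:] * g'" by (auto simp: poly_eq_0_iff_dvd)
    hence "f = [:-z, 1:] ^ 2 * g'" unfolding g by (simp only: power2_eq_square mult.assoc)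
    hence "[:-z, 1:] ^ 2 dvd f" by simp
    thus ?thesis using f0' order_divides[of z 2 f] by auto
  qed
  have disj: "Z \<inter> X = {}" using Z(3) Xroot by fastforce
  have "3 * N = (\<Sum>z\<in>Z. 2) + (\<Sum>x\<in>X. 1)" using Z X by simp
  also have "\<dots> \<le> (\<Sum>z\<in>Z. order z f) + (\<Sum>x\<in>X. order x f)"
    by (intro add_mono sum_mono Zord Xord)
  also have "\<dots> = (\<Sum>x\<in>Z \<union> X. order x f)"
    using Z(1) X(1) disj by (simp add: sum.union_disjoint)
  also have "\<dots> \<le> num_nonzero_roots f"
    unfolding num_nonzero_roots_def
  proof (rule sum_mono2)
    show "finite {x. x \<noteq> 0 \<and> poly f x = 0}"
      by (rule finite_subset[OF _ poly_roots_finite[OF f0']]) auto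
    have "poly f z = 0" if "z \<in> Z" for z using Zord[OF that] f0' by (simp add: order_root)
    thus "Z \<union> X \<subseteq> {x. x \<noteq> 0 \<and> poly f x = 0}" using Z(3) Xroot by fastforce
  qed auto
  finally show "num_nonzero_roots (extremal_trinomial a) \<ge> 3 * (q - 1)" by (simp add: f_def N_def)
qed

lemma B_m_2_eq:
  assumes p: "p > 2 + e"
  shows "B_m 2 TYPE('k) = enat (3 * (q - 1))"
proof (rule antisym)
  show "B_m 2 TYPE('k) \<le> enat (3 * (q - 1))"
    unfolding B_m_def by (rule SUP_least) (use trinomial_roots_le[OF p] in auto)
  have "enat (3 * (q - 1)) \<le> enat (num_nonzero_roots (extremal_trinomial (p ^ (q - 1))))"
    using extremal_trinomial_roots(3)[OF refl] by simp
  also have "\<dots> \<le> B_m 2 TYPE('k)"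
    unfolding B_m_def using extremal_trinomial_roots(1,2)[OF refl] by (intro SUP_upper) auto
  finally show "enat (3 * (q - 1)) \<le> B_m 2 TYPE('k)" .
qed

end

section \<open>The \<open>p\<close>-adic numbers are complete\<close>

lift_definition padic_of_rat :: "rat \<Rightarrow> 'p::prime_card padic" is "\<lambda>r _. r"
  by (simp add: padic_rel_refl prime_card)

lemma padic_of_rat_add: "padic_of_rat (r + s) = padic_of_rat r + padic_of_rat s"
  by transfer (simp add: padic_rel_refl prime_card)

lemma padic_of_rat_uminus: "padic_of_rat (- r) = - padic_of_rat r"
  by transfer (simp add: padic_rel_refl prime_card)

lemma padic_of_rat_diff: "padic_of_rat (r - s) = padic_of_rat r - padic_of_rat s"
  using padic_of_rat_add[of r "- s"] by (simp add: padic_of_rat_uminus)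

lemma padic_of_rat_of_nat: "padic_of_rat (of_nat n) = of_nat n"
proof (induction n)
  case 0
  show ?case by simp (transfer, simp add: padic_rel_refl prime_card)
next
  case (Suc n)
  have "padic_of_rat 1 = (1 :: 'a padic)" by transfer (simp add: padic_rel_refl prime_card)
  thus ?case using Suc by (simp add: padic_of_rat_add)
qed

lemma padic_abs_of_rat: "padic_abs (padic_of_rat r :: 'p::prime_card padic) = rat_padic_abs CARD('p) r"
  by transfer simp

lemma padic_of_rat_dense:
  assumes "\<epsilon> > 0"
  shows "\<exists>r. padic_abs (x - padic_of_rat r :: 'p::prime_card padic) < \<epsilon>"
  unfolding minus_padic_def using assms
proof (transfer fixing: \<epsilon>)
  fix X assume e: "\<epsilon> > 0" and "padic_rel TYPE('p) X X"
  hence X: "padic_cauchy CARD('p) X" by (simp add: padic_rel_refl)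
  obtain N where N: "\<And>m n. m \<ge> N \<Longrightarrow> n \<ge> N \<Longrightarrow> rat_padic_abs CARD('p) (X m - X n) < \<epsilon> / 2"
    using X e unfolding padic_cauchy_def by (meson half_gt_zero)
  have "padic_cauchy CARD('p) (\<lambda>n. X n + - X N)"
    by (intro padic_cauchy_add[OF prime_card] X padic_cauchy_const[OF prime_card])
  hence "convergent (\<lambda>n. rat_padic_abs CARD('p) (X n + - X N))"
    by (rule padic_abs_convergent[OF prime_card])
  hence "(\<lambda>n. rat_padic_abs CARD('p) (X n + - X N)) \<longlonglongrightarrow> lim (\<lambda>n. rat_padic_abs CARD('p) (X n + - X N))"
    by (simp add: convergent_LIMSEQ_iff)
  moreover have "\<exists>M. \<forall>n\<ge>M. rat_padic_abs CARD('p) (X n + - X N) \<le> \<epsilon> / 2"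
    using N[of _ N] by (intro exI[of _ N]) (auto intro: less_imp_le)
  ultimately have "lim (\<lambda>n. rat_padic_abs CARD('p) (X n + - X N)) \<le> \<epsilon> / 2"
    by (rule LIMSEQ_le_const2)
  thus "\<exists>r. lim (\<lambda>n. rat_padic_abs CARD('p) (X n + - r)) < \<epsilon>"
    using e by (intro exI[of _ "X N"]) simp
qed

lemma padic_of_rat_cauchy_limit:
  assumes "padic_cauchy CARD('p::prime_card) X"
  shows "\<exists>L. \<forall>\<epsilon>>0. \<exists>N. \<forall>n\<ge>N. padic_abs (padic_of_rat (X n) - L :: 'p padic) \<le> \<epsilon>"
  unfolding minus_padic_def
proof (transfer fixing: X)
  have "\<exists>N. \<forall>n\<ge>N. lim (\<lambda>m. rat_padic_abs CARD('p) (X n + - X m)) \<le> \<epsilon>" if e: "\<epsilon> > 0" for \<epsilon>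
  proof -
    obtain N where N: "\<And>m n. m \<ge> N \<Longrightarrow> n \<ge> N \<Longrightarrow> rat_padic_abs CARD('p) (X m - X n) < \<epsilon>"
      using assms e unfolding padic_cauchy_def by meson
    have "lim (\<lambda>m. rat_padic_abs CARD('p) (X n + - X m)) \<le> \<epsilon>" if n: "n \<ge> N" for n
    proof (rule LIMSEQ_le_const2)
      have "padic_cauchy CARD('p) (\<lambda>m. X n + - X m)"
        by (intro padic_cauchy_add[OF prime_card] padic_cauchy_minus[OF prime_card] assms
            padic_cauchy_const[OF prime_card])
      hence "convergent (\<lambda>m. rat_padic_abs CARD('p) (X n + - X m))"
        by (rule padic_abs_convergent[OF prime_card])
      thus "(\<lambda>m. rat_padic_abs CARD('p) (X n + - X m)) \<longlonglongrightarrow> lim (\<lambda>m. rat_padic_abs CARD('p) (X n + - X m))"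
        by (simp add: convergent_LIMSEQ_iff)
      show "\<exists>M. \<forall>m\<ge>M. rat_padic_abs CARD('p) (X n + - X m) \<le> \<epsilon>"
        using N[OF n] by (intro exI[of _ N]) (auto intro: less_imp_le)
    qed
    thus ?thesis by blast
  qed
  thus "\<exists>L\<in>{L. padic_rel TYPE('p) L L}. \<forall>\<epsilon>>0. \<exists>N. \<forall>n\<ge>N. lim (\<lambda>m. rat_padic_abs CARD('p) (X n + - L m)) \<le> \<epsilon>"
    using assms by (intro bexI[of _ X]) (auto simp: padic_rel_refl)
qed

text \<open>
  The axioms of an absolute value are assumed here because they are inherited from any absolute value
  on an extension field that restricts to \<open>padic_abs\<close>.
\<close>

context
  assumes nonarch: "nonarchimedean (padic_abs :: 'p::prime_card padic \<Rightarrow> real)"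
begin

interpretation P: nonarchimedean "padic_abs :: 'p padic \<Rightarrow> real" by (rule nonarch)

lemma padic_abs_value:
  assumes "(x :: 'p padic) \<noteq> 0"
  shows "\<exists>n::int. padic_abs x = real CARD('p) powi n"
proof -
  obtain r where r: "padic_abs (x - padic_of_rat r) < padic_abs x"
    using padic_of_rat_dense[of "padic_abs x" x] P.v_pos[OF assms] by blast
  have "padic_abs x = padic_abs (padic_of_rat r :: 'p padic)"
    using P.v_eq_of_diff_less[of "padic_of_rat r" x] r by (simp add: P.v_minus_commute)
  hence eq: "padic_abs x = rat_padic_abs CARD('p) r" by (simp add: padic_abs_of_rat)
  moreover have "r \<noteq> 0"
    using eq P.v_pos[OF assms] rat_padic_abs_0[OF prime_card[where 'a='p]] by auto
  ultimately show ?thesis by (auto simp: rat_padic_abs_def)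
qed

lemma padic_abs_CARD: "padic_abs (of_nat CARD('p) :: 'p padic) = 1 / real CARD('p)"
proof -
  have "prime (int CARD('p))" using prime_card[where 'a='p] by simp
  hence "rat_padic_val CARD('p) (of_nat CARD('p)) = 1"
    using rat_padic_val_frac[OF prime_card[where 'a='p], of "int CARD('p)" 1]
    by (simp add: multiplicity_self not_prime_unit prime_gt_0_int)
  moreover have "padic_abs (of_nat CARD('p) :: 'p padic) = rat_padic_abs CARD('p) (of_nat CARD('p))"
    by (simp only: padic_abs_of_rat flip: padic_of_rat_of_nat)
  ultimately show ?thesis by (simp add: rat_padic_abs_def power_int_minus divide_inverse)
qed

text \<open>
  Replace a Cauchy sequence by rational numbers approximating its terms; these form a Cauchy sequence
  of rationals, whose class is the limit.
\<close>

lemma padic_complete: "v_complete (padic_abs :: 'p padic \<Rightarrow> real)"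
  unfolding v_complete_on_def
proof (intro allI impI, elim conjE)
  fix X :: "nat \<Rightarrow> 'p padic"
  assume X: "\<forall>\<epsilon>>0. \<exists>N. \<forall>m\<ge>N. \<forall>n\<ge>N. padic_abs (X m - X n) < \<epsilon>"
  have "\<exists>r. padic_abs (X n - padic_of_rat r) < 1 / real (Suc n)" for n
    by (rule padic_of_rat_dense) simp
  then obtain r where r: "\<And>n. padic_abs (X n - padic_of_rat (r n)) < 1 / real (Suc n)" by metis
  have close: "\<exists>N. \<forall>n\<ge>N. padic_abs (X n - padic_of_rat (r n)) < \<epsilon>" if e: "\<epsilon> > 0" for \<epsilon>
  proof -
    obtain N where N: "1 / real (Suc N) < \<epsilon>" using nat_approx_posE[OF e] by blast
    have "padic_abs (X n - padic_of_rat (r n)) < \<epsilon>" if "n \<ge> N" for n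
    proof -
      have "1 / real (Suc n) \<le> 1 / real (Suc N)" using that by (intro divide_left_mono) auto
      thus ?thesis using r[of n] N by linarith
    qed
    thus ?thesis by blast
  qed
  have "padic_cauchy CARD('p) r"
    unfolding padic_cauchy_def
  proof (intro allI impI)
    fix \<epsilon> :: real assume e: "\<epsilon> > 0"
    obtain M where M: "\<And>m n. m \<ge> M \<Longrightarrow> n \<ge> M \<Longrightarrow> padic_abs (X m - X n) < \<epsilon>" using X e by meson
    obtain N where N: "\<And>n. n \<ge> N \<Longrightarrow> padic_abs (X n - padic_of_rat (r n)) < \<epsilon>" using close[OF e] by blast
    have "rat_padic_abs CARD('p) (r m - r n) < \<epsilon>" if "m \<ge> max M N" "n \<ge> max M N" for m n
    proof -
      have "padic_of_rat (r m - r n) =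
          (X m - X n) - (X m - padic_of_rat (r m)) + (X n - padic_of_rat (r n))"
        by (simp add: padic_of_rat_diff)
      also have "padic_abs \<dots> < \<epsilon>"
        using that by (intro P.v_add_less[OF P.v_diff_less[OF M N] N]) auto
      finally show ?thesis by (simp add: padic_abs_of_rat)
    qed
    thus "\<exists>N. \<forall>m\<ge>N. \<forall>n\<ge>N. rat_padic_abs CARD('p) (r m - r n) < \<epsilon>" by blast
  qed
  from padic_of_rat_cauchy_limit[OF this] obtain L :: "'p padic" where
    L: "\<And>\<epsilon>. \<epsilon> > 0 \<Longrightarrow> \<exists>N. \<forall>n\<ge>N. padic_abs (padic_of_rat (r n) - L) \<le> \<epsilon>" by blast
  have "(\<lambda>n. padic_abs (X n - L)) \<longlonglongrightarrow> 0"
  proof (rule LIMSEQ_I)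
    fix \<epsilon> :: real assume e: "\<epsilon> > 0"
    obtain M where M: "\<And>n. n \<ge> M \<Longrightarrow> padic_abs (padic_of_rat (r n) - L) \<le> \<epsilon> / 2"
      using L[of "\<epsilon> / 2"] e by auto
    obtain N where N: "\<And>n. n \<ge> N \<Longrightarrow> padic_abs (X n - padic_of_rat (r n)) < \<epsilon>" using close[OF e] by blast
    have "padic_abs (X n - L) < \<epsilon>" if "n \<ge> max M N" for n
    proof -
      have "padic_abs ((X n - padic_of_rat (r n)) + (padic_of_rat (r n) - L)) < \<epsilon>"
        using M[of n] N[of n] that e by (intro P.v_add_less) auto
      thus ?thesis by simp
    qed
    thus "\<exists>no. \<forall>n\<ge>no. norm (padic_abs (X n - L) - 0) < \<epsilon>"
      by (intro exI[of _ "max M N"]) simp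
  qed
  thus "\<exists>L\<in>UNIV. (\<lambda>n. padic_abs (X n - L)) \<longlonglongrightarrow> 0" by blast
qed

text \<open>
  A rational number close to \<open>x\<close> has a denominator \<open>b\<close> prime to \<open>p\<close>, so its residue is obtained by
  inverting \<open>b\<close> modulo \<open>p\<close>.
\<close>

lemma padic_integer_residue:
  assumes "padic_abs (x :: 'p padic) \<le> 1"
  shows "\<exists>n<CARD('p). padic_abs (x - of_nat n) < 1"
proof -
  note pc = prime_card[where 'a='p]
  have pI: "prime (int CARD('p))" using pc by simp
  obtain r where r: "padic_abs (x - padic_of_rat r) < 1" using padic_of_rat_dense[of 1 x] by auto
  have r1: "rat_padic_abs CARD('p) r \<le> 1"
  proof -
    have "padic_abs (x - (x - padic_of_rat r)) \<le> 1" using assms r by (intro P.v_diff_le[of x _ "x - padic_of_rat r"]) auto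
    thus ?thesis by (simp add: padic_abs_of_rat)
  qed
  obtain a b where ab: "quotient_of r = (a, b)" by fastforce
  have b: "b > 0" "coprime a b" and r_eq: "r = of_int a / of_int b"
    using quotient_of_denom_pos[OF ab] quotient_of_coprime[OF ab] quotient_of_div[OF ab] by auto
  have "\<not> int CARD('p) dvd b"
  proof
    assume dvd: "int CARD('p) dvd b"
    hence "\<not> int CARD('p) dvd a" using b(2) pI not_coprimeI by (metis not_prime_unit)
    hence a: "multiplicity (int CARD('p)) a = 0" "a \<noteq> 0" by (auto simp: not_dvd_imp_multiplicity_0)
    have "multiplicity (int CARD('p)) b > 0"
      using dvd b pI by (simp add: prime_multiplicity_gt_zero_iff)
    hence "rat_padic_val CARD('p) r < 0" using a by (simp add: rat_padic_val_def ab)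
    hence "1 < rat_padic_abs CARD('p) r"
      using a r_eq b prime_gt_1_nat[OF pc] by (auto simp: rat_padic_abs_def intro!: one_less_power_int)
    thus False using r1 by simp
  qed
  hence "coprime b (int CARD('p))" using pI prime_imp_coprime coprime_commute by blast
  then obtain c where c: "[b * c = 1] (mod int CARD('p))" using cong_solve_coprime_int by blast
  define n where "n = nat ((a * c) mod int CARD('p))"
  have ppos: "int CARD('p) > 0" using prime_gt_0_nat[OF pc] by simp
  have n: "n < CARD('p)" "int n = (a * c) mod int CARD('p)"
    unfolding n_def using ppos by (auto simp: nat_less_iff)
  have "[b * int n = b * (a * c)] (mod int CARD('p))"
    unfolding n(2) by (intro cong_scalar_left) (simp add: cong_def)
  also have "b * (a * c) = a * (b * c)" by simp
  also have "[a * (b * c) = a * 1] (mod int CARD('p))" by (intro cong_scalar_left c)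
  finally have dvd: "int CARD('p) dvd a - b * int n"
    by (metis cong_iff_dvd_diff cong_sym mult.right_neutral)
  have "rat_padic_abs CARD('p) (r - of_nat n) < 1"
  proof (cases "r = of_nat n")
    case True
    thus ?thesis using rat_padic_abs_0[OF pc] by simp
  next
    case False
    have eq: "r - of_nat n = of_int (a - b * int n) / of_int b" using b by (simp add: r_eq field_simps)
    have nz: "a - b * int n \<noteq> 0" using False eq by auto
    have "multiplicity (int CARD('p)) (a - b * int n) > 0"
      using dvd nz pI by (simp add: prime_multiplicity_gt_zero_iff)
    moreover have "multiplicity (int CARD('p)) b = 0"
      using \<open>\<not> int CARD('p) dvd b\<close> by (rule not_dvd_imp_multiplicity_0)
    ultimately have "rat_padic_val CARD('p) (r - of_nat n) > 0"
      using rat_padic_val_frac[OF pc nz, of b] b unfolding eq by simp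
    thus ?thesis using False prime_gt_1_nat[OF pc]
      by (auto simp: rat_padic_abs_def power_int_minus intro!: inverse_less_1_iff[THEN iffD2] one_less_power_int)
  qed
  hence "padic_abs (padic_of_rat r - of_nat n :: 'p padic) < 1"
    by (simp add: padic_abs_of_rat flip: padic_of_rat_of_nat padic_of_rat_diff)
  from P.v_add_less[OF r this] show ?thesis using n(1) by auto
qed

end

section \<open>Finite extensions: completeness and ramification\<close>

lemma (in nonarchimedean) sum_nonzero_of_distinct_values:
  assumes "finite I" "I \<noteq> {}" "\<And>i. i \<in> I \<Longrightarrow> g i \<noteq> 0" "inj_on (\<lambda>i. v (g i)) I"
  shows "sum g I \<noteq> 0"
proof -
  have "Max ((\<lambda>i. v (g i)) ` I) \<in> (\<lambda>i. v (g i)) ` I" using assms by (intro Max_in) auto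
  then obtain j where j: "j \<in> I" "v (g j) = Max ((\<lambda>i. v (g i)) ` I)" by auto
  have "v (g i) < v (g j)" if "i \<in> I - {j}" for i
  proof -
    have "v (g i) \<le> v (g j)" unfolding j(2) using that assms(1) by (intro Max_ge) auto
    moreover have "v (g i) \<noteq> v (g j)" using inj_onD[OF assms(4), of i j] that j(1) by auto
    ultimately show ?thesis by simp
  qed
  hence "v (sum g (I - {j})) < v (g j)" using assms(3)[OF j(1)] by (intro v_sum_less v_pos) auto
  hence "v (sum g I) = v (g j)" using assms(1) j(1) by (simp add: sum.remove v_add_dominant)
  thus ?thesis using assms(3)[OF j(1)] by auto
qed

locale padic_extension =
  fixes \<iota> :: "'p::prime_card padic \<Rightarrow> 'k::field" and v :: "'k \<Rightarrow> real"
  assumes finite_ext: "finite_padic_extension \<iota>" and extends: "extends_padic_abs \<iota> v"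
begin

sublocale nonarchimedean v
  using extends unfolding extends_padic_abs_def by unfold_locales blast+

lemma v_emb: "v (\<iota> a) = padic_abs a"
  using extends by (simp add: extends_padic_abs_def)

sublocale emb: field_hom \<iota>
  using finite_ext by (simp add: finite_padic_extension_def)

lemma nonarchimedean_padic_abs: "nonarchimedean (padic_abs :: 'p padic \<Rightarrow> real)"
proof
  fix x y :: "'p padic"
  show "padic_abs x \<ge> 0" using v_nonneg[of "\<iota> x"] by (simp only: v_emb)
  show "padic_abs x = 0 \<longleftrightarrow> x = 0" using v_eq_0[of "\<iota> x"] by (simp add: v_emb)
  show "padic_abs (x * y) = padic_abs x * padic_abs y"
    using v_mult[of "\<iota> x" "\<iota> y"] by (simp add: v_emb flip: emb.hom_mult)
  show "padic_abs (x + y) \<le> max (padic_abs x) (padic_abs y)"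
    using v_add[of "\<iota> x" "\<iota> y"] by (simp add: v_emb flip: emb.hom_add)
qed

sublocale P: nonarchimedean "padic_abs :: 'p padic \<Rightarrow> real"
  by (rule nonarchimedean_padic_abs)

lemma v_CARD: "v (of_nat CARD('p)) = 1 / real CARD('p)"
proof -
  have "(of_nat CARD('p) :: 'k) = \<iota> (of_nat CARD('p))" by (simp only: emb.hom_of_nat)
  thus ?thesis using padic_abs_CARD[OF nonarchimedean_padic_abs] by (simp only: v_emb)
qed

text \<open>
  One step of the proof that finite-dimensional spaces are complete. A complete subspace \<open>W\<close> is closed,
  so \<open>b\<close> has a positive distance \<open>\<delta>\<close> from it; therefore the \<open>b\<close>-coordinate of a Cauchy sequence is
  Cauchy, and so is the remaining component in \<open>W\<close>.
\<close>

lemma complete_span_insert: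
  fixes W :: "'k set"
  assumes W: "\<And>x y. x \<in> W \<Longrightarrow> y \<in> W \<Longrightarrow> x - y \<in> W" "\<And>a x. x \<in> W \<Longrightarrow> \<iota> a * x \<in> W"
    and complete: "v_complete_on v W" and b: "b \<notin> W"
  shows "v_complete_on v {x. \<exists>a. x - \<iota> a * b \<in> W}"
proof -
  have "\<exists>\<delta>>0. \<forall>w\<in>W. v (b - w) \<ge> \<delta>"
  proof (rule ccontr)
    assume "\<not> ?thesis"
    hence "\<exists>w\<in>W. v (b - w) < 1 / real (Suc n)" for n
      by (metis linorder_not_le of_nat_0_less_iff zero_less_Suc zero_less_divide_1_iff)
    then obtain w where w: "\<And>n. w n \<in> W" "\<And>n. v (b - w n) < 1 / real (Suc n)" by metis
    have lim: "(\<lambda>n. v (w n - b)) \<longlonglongrightarrow> 0"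
    proof (rule tendsto_sandwich[OF _ _ tendsto_const])
      show "(\<lambda>n. 1 / real (Suc n)) \<longlonglongrightarrow> 0" using LIMSEQ_inverse_real_of_nat by (simp add: inverse_eq_divide)
      show "\<forall>\<^sub>F n in sequentially. v (w n - b) \<le> 1 / real (Suc n)"
        by (intro always_eventually allI) (metis less_imp_le w(2) v_minus_commute)
    qed simp
    have "\<exists>N. \<forall>m\<ge>N. \<forall>n\<ge>N. v (w m - w n) < \<epsilon>" if \<epsilon>: "\<epsilon> > 0" for \<epsilon>
    proof -
      obtain N where N: "\<And>n. n \<ge> N \<Longrightarrow> v (w n - b) < \<epsilon>"
        using order_tendstoD(2)[OF lim \<epsilon>] by (auto simp: eventually_sequentially)
      have "v (w m - w n) < \<epsilon>" if "m \<ge> N" "n \<ge> N" for m n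
        using v_diff_less[OF N[OF that(1)] N[OF that(2)]] by simp
      thus ?thesis by blast
    qed
    then obtain L where L: "L \<in> W" "(\<lambda>n. v (w n - L)) \<longlonglongrightarrow> 0"
      using complete w(1) unfolding v_complete_on_def by blast
    have "v (b - L) \<le> max (v (w n - b)) (v (w n - L))" for n
      using v_diff[of "w n - L" "w n - b"] by (simp add: max.commute)
    hence "v (b - L) \<le> 0"
      using tendsto_max[OF lim L(2)] by (intro tendsto_lowerbound[of _ 0 sequentially]) auto
    hence "b = L" by (metis antisym v_nonneg v_eq_0 eq_iff_diff_eq_0)
    thus False using b L(1) by simp
  qed
  then obtain \<delta> where \<delta>: "\<delta> > 0" "\<And>w. w \<in> W \<Longrightarrow> v (b - w) \<ge> \<delta>" by blast
  have coord: "padic_abs a * \<delta> \<le> v (\<iota> a * b + w)" if w: "w \<in> W" for a w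
  proof (cases "a = 0")
    case False
    hence "\<iota> (a * - inverse a) = -1" by (simp add: emb.hom_uminus)
    hence inv: "\<iota> a * \<iota> (- inverse a) = -1" by (simp only: emb.hom_mult)
    have "\<iota> (- inverse a) * w \<in> W" by (rule W(2)[OF w])
    hence "\<delta> \<le> v (b - \<iota> (- inverse a) * w)" by (rule \<delta>(2))
    hence "padic_abs a * \<delta> \<le> v (\<iota> a * (b - \<iota> (- inverse a) * w))"
      by (simp add: v_mult v_emb mult_left_mono)
    also have "\<iota> a * (b - \<iota> (- inverse a) * w) = \<iota> a * b + w"
      by (simp only: right_diff_distrib mult.assoc[symmetric] inv) simp
    finally show ?thesis .
  qed simp
  show ?thesis
    unfolding v_complete_on_def
  proof (intro allI impI, elim conjE)
    fix X :: "nat \<Rightarrow> 'k"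
    assume X: "range X \<subseteq> {x. \<exists>a. x - \<iota> a * b \<in> W}"
      and cauchy: "\<forall>\<epsilon>>0. \<exists>N. \<forall>m\<ge>N. \<forall>n\<ge>N. v (X m - X n) < \<epsilon>"
    have "\<exists>a. X n - \<iota> a * b \<in> W" for n using X by auto
    then obtain a where a: "\<And>n. X n - \<iota> (a n) * b \<in> W" by metis
    define w where "w n = X n - \<iota> (a n) * b" for n
    have w: "w n \<in> W" for n using a by (simp add: w_def)
    have bound: "padic_abs (a m - a n) * \<delta> \<le> v (X m - X n)" for m n
    proof -
      have "X m - X n = \<iota> (a m - a n) * b + (w m - w n)"
        by (simp add: w_def emb.hom_minus algebra_simps)
      thus ?thesis using coord[OF W(1)[OF w w]] by simp
    qed
    have a_cauchy: "\<exists>N. \<forall>m\<ge>N. \<forall>n\<ge>N. padic_abs (a m - a n) < \<epsilon>" if \<epsilon>: "\<epsilon> > 0" for \<epsilon>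
    proof -
      obtain N where N: "\<And>m n. m \<ge> N \<Longrightarrow> n \<ge> N \<Longrightarrow> v (X m - X n) < \<epsilon> * \<delta>"
        using cauchy \<epsilon> \<delta>(1) by (meson mult_pos_pos)
      have "padic_abs (a m - a n) < \<epsilon>" if "m \<ge> N" "n \<ge> N" for m n
        using le_less_trans[OF bound N[OF that]] \<delta>(1) by simp
      thus ?thesis by blast
    qed
    then obtain \<alpha> where \<alpha>: "(\<lambda>n. padic_abs (a n - \<alpha>)) \<longlonglongrightarrow> 0"
      using padic_complete[OF nonarchimedean_padic_abs] unfolding v_complete_on_def by blast
    have "\<exists>N. \<forall>m\<ge>N. \<forall>n\<ge>N. v (w m - w n) < \<epsilon>" if \<epsilon>: "\<epsilon> > 0" for \<epsilon>
    proof -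
      have "\<epsilon> / (v b + 1) > 0" using \<epsilon> v_nonneg[of b] by (intro divide_pos_pos add_nonneg_pos) auto
      then obtain M where M: "\<And>m n. m \<ge> M \<Longrightarrow> n \<ge> M \<Longrightarrow> padic_abs (a m - a n) < \<epsilon> / (v b + 1)"
        using a_cauchy by blast
      obtain N where N: "\<And>m n. m \<ge> N \<Longrightarrow> n \<ge> N \<Longrightarrow> v (X m - X n) < \<epsilon>"
        using cauchy \<epsilon> by meson
      have "v (w m - w n) < \<epsilon>" if mn: "m \<ge> max M N" "n \<ge> max M N" for m n
      proof -
        have "padic_abs (a m - a n) * v b \<le> padic_abs (a m - a n) * (v b + 1)"
          by (intro mult_left_mono) auto
        also have "\<dots> < \<epsilon>"
          using M[of m n] mn v_nonneg[of b] by (simp add: pos_less_divide_eq)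
        finally have "v (\<iota> (a m - a n) * b) < \<epsilon>" by (simp add: v_mult v_emb)
        moreover have "w m - w n = (X m - X n) - \<iota> (a m - a n) * b"
          by (simp add: w_def emb.hom_minus algebra_simps)
        ultimately show ?thesis using N[of m n] mn by (simp add: v_diff_less)
      qed
      thus ?thesis by blast
    qed
    then obtain \<omega> where \<omega>: "\<omega> \<in> W" "(\<lambda>n. v (w n - \<omega>)) \<longlonglongrightarrow> 0"
      using complete w unfolding v_complete_on_def by blast
    have lim: "(\<lambda>n. max (padic_abs (a n - \<alpha>) * v b) (v (w n - \<omega>))) \<longlonglongrightarrow> 0"
      using tendsto_max[OF tendsto_mult_left_zero[OF \<alpha>] \<omega>(2)] by simp
    have "(\<lambda>n. v (X n - (\<iota> \<alpha> * b + \<omega>))) \<longlonglongrightarrow> 0"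
    proof (rule tendsto_sandwich[OF _ _ tendsto_const lim])
      have "v (X n - (\<iota> \<alpha> * b + \<omega>)) \<le> max (padic_abs (a n - \<alpha>) * v b) (v (w n - \<omega>))" for n
      proof -
        have "X n - (\<iota> \<alpha> * b + \<omega>) = \<iota> (a n - \<alpha>) * b + (w n - \<omega>)"
          by (simp add: w_def emb.hom_minus algebra_simps)
        moreover have "v (\<iota> (a n - \<alpha>) * b) = padic_abs (a n - \<alpha>) * v b" by (simp only: v_mult v_emb)
        ultimately show ?thesis using v_add[of "\<iota> (a n - \<alpha>) * b" "w n - \<omega>"] by (simp only:)
      qed
      thus "\<forall>\<^sub>F n in sequentially. v (X n - (\<iota> \<alpha> * b + \<omega>))
          \<le> max (padic_abs (a n - \<alpha>) * v b) (v (w n - \<omega>))" by simp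
    qed simp
    moreover have "\<iota> \<alpha> * b + \<omega> \<in> {x. \<exists>a. x - \<iota> a * b \<in> W}" using \<omega>(1)
      by (intro CollectI exI[of _ \<alpha>]) simp
    ultimately show "\<exists>L\<in>{x. \<exists>a. x - \<iota> a * b \<in> W}. (\<lambda>n. v (X n - L)) \<longlonglongrightarrow> 0" by blast
  qed
qed

lemma v_complete_extension: "v_complete v"
proof -
  obtain B where "finite_dimensional_vector_space (\<lambda>a x. \<iota> a * x) B"
    using finite_ext by (auto simp: finite_padic_extension_def)
  then interpret V: finite_dimensional_vector_space "\<lambda>a x. \<iota> a * x" B .
  have "v_complete_on v (V.span C)" if "finite C" "V.independent C" for C
    using that
  proof (induction C)
    case empty
    have "(\<lambda>n. v (X n - 0)) \<longlonglongrightarrow> 0" if "range X \<subseteq> {0}" for X :: "nat \<Rightarrow> 'k"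
    proof -
      have "X n = 0" for n using that by auto
      thus ?thesis by simp
    qed
    thus ?case unfolding v_complete_on_def V.span_empty by blast
  next
    case (insert b C)
    hence indep: "V.independent C" "b \<notin> V.span C" by (auto simp: V.independent_insert)
    have "v_complete_on v {x. \<exists>a. x - \<iota> a * b \<in> V.span C}"
      by (rule complete_span_insert[OF V.span_diff V.span_scale insert.IH[OF indep(1)] indep(2)])
    thus ?case by (simp add: V.span_insert)
  qed
  from this[OF V.finite_Basis V.independent_Basis] show ?thesis by (simp add: V.span_Basis)
qed

lemma comm_group_value_group: "comm_group (value_group v)"
proof (rule comm_groupI)
  fix x y assume x: "x \<in> carrier (value_group v)" and y: "y \<in> carrier (value_group v)"
  then obtain a b where ab: "x = v a" "a \<noteq> 0" "y = v b" "b \<noteq> 0" by (auto simp: value_group_def)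
  show "x \<otimes>\<^bsub>value_group v\<^esub> y \<in> carrier (value_group v)"
    using ab by (auto simp: value_group_def simp flip: v_mult)
  show "\<exists>y\<in>carrier (value_group v). y \<otimes>\<^bsub>value_group v\<^esub> x = \<one>\<^bsub>value_group v\<^esub>"
    using ab by (intro bexI[of _ "v (inverse a)"]) (auto simp: value_group_def simp flip: v_mult)
qed (auto simp: value_group_def intro: image_eqI[of _ _ 1])

lemma value_subgroup: "subgroup (carrier (value_group (padic_abs :: 'p padic \<Rightarrow> real))) (value_group v)"
proof -
  interpret G: comm_group "value_group v" by (rule comm_group_value_group)
  show ?thesis
  proof (rule G.subgroupI)
    show "carrier (value_group (padic_abs :: 'p padic \<Rightarrow> real)) \<subseteq> carrier (value_group v)"
      by (auto simp: value_group_def simp flip: v_emb)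
    have "padic_abs (1 :: 'p padic) \<in> carrier (value_group (padic_abs :: 'p padic \<Rightarrow> real))"
      unfolding value_group_def by (simp del: P.v_one)
    thus "carrier (value_group (padic_abs :: 'p padic \<Rightarrow> real)) \<noteq> {}" by blast
    fix x assume "x \<in> carrier (value_group (padic_abs :: 'p padic \<Rightarrow> real))"
    then obtain a where a: "x = padic_abs a" "(a :: 'p padic) \<noteq> 0" by (auto simp: value_group_def)
    have "inv\<^bsub>value_group v\<^esub> x = padic_abs (inverse a)"
    proof (rule G.inv_equality)
      show "padic_abs (inverse a) \<otimes>\<^bsub>value_group v\<^esub> x = \<one>\<^bsub>value_group v\<^esub>"
        using a by (simp add: value_group_def flip: P.v_mult)
    qed (use a in \<open>auto simp: value_group_def simp flip: v_emb\<close>)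
    thus "inv\<^bsub>value_group v\<^esub> x \<in> carrier (value_group (padic_abs :: 'p padic \<Rightarrow> real))"
      using a by (auto simp: value_group_def)
    fix y assume "y \<in> carrier (value_group (padic_abs :: 'p padic \<Rightarrow> real))"
    then obtain b where b: "y = padic_abs b" "(b :: 'p padic) \<noteq> 0" by (auto simp: value_group_def)
    show "x \<otimes>\<^bsub>value_group v\<^esub> y \<in> carrier (value_group (padic_abs :: 'p padic \<Rightarrow> real))"
      using a b by (auto simp: value_group_def simp flip: P.v_mult)
  qed
qed

text \<open>
  Field elements whose values lie in different cosets are linearly independent, since the non-zero
  terms of a linear combination have distinct values. So the number of cosets is at most the degree.
\<close>

lemma finite_value_cosets:
  "finite (rcosets\<^bsub>value_group v\<^esub> (carrier (value_group (padic_abs :: 'p padic \<Rightarrow> real))))"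
    (is "finite (rcosets\<^bsub>?G\<^esub> ?H)")
proof -
  interpret G: comm_group ?G by (rule comm_group_value_group)
  obtain B where "finite_dimensional_vector_space (\<lambda>a x. \<iota> a * x) B"
    using finite_ext by (auto simp: finite_padic_extension_def)
  then interpret V: finite_dimensional_vector_space "\<lambda>a x. \<iota> a * x" B .
  have "card F \<le> V.dim UNIV" if F: "F \<subseteq> rcosets\<^bsub>?G\<^esub> ?H" "finite F" for F
  proof -
    have "\<exists>x. x \<noteq> 0 \<and> C = ?H #>\<^bsub>?G\<^esub> v x" if "C \<in> F" for C
      using F(1) that by (auto simp: RCOSETS_def value_group_def)
    then obtain g where g: "\<And>C. C \<in> F \<Longrightarrow> g C \<noteq> 0 \<and> C = ?H #>\<^bsub>?G\<^esub> v (g C)" by metis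
    have inj: "inj_on g F" using g by (metis inj_onI)
    have same_coset: "?H #>\<^bsub>?G\<^esub> v x = ?H #>\<^bsub>?G\<^esub> v y"
      if "x \<noteq> 0" "y \<noteq> 0" "a \<noteq> 0" "b \<noteq> 0" "v (\<iota> a * x) = v (\<iota> b * y)" for x y a b
    proof (rule G.repr_independence[OF _ _ value_subgroup])
      have "padic_abs a * v x = padic_abs b * v y" using that(5) by (simp add: v_mult v_emb)
      moreover have "padic_abs b > 0" using that by (intro P.v_pos)
      ultimately have "v y = padic_abs (a / b) * v x"
        using that(4) by (simp add: P.v_divide field_simps)
      thus "v y \<in> ?H #>\<^bsub>?G\<^esub> v x" using that by (auto simp: r_coset_def value_group_def)
      show "v x \<in> carrier ?G" using that by (simp add: value_group_def)
    qed
    have "V.independent (g ` F)"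
    proof (rule V.independent_if_scalars_zero)
      show "finite (g ` F)" using F by simp
      fix u x assume sum: "(\<Sum>y\<in>g ` F. \<iota> (u y) * y) = 0" and x: "x \<in> g ` F"
      define J where "J = {y \<in> g ` F. u y \<noteq> 0}"
      show "u x = 0"
      proof (rule ccontr)
        assume "u x \<noteq> 0"
        have "(\<Sum>y\<in>J. \<iota> (u y) * y) \<noteq> 0"
        proof (rule sum_nonzero_of_distinct_values)
          show "finite J" "J \<noteq> {}" using F x \<open>u x \<noteq> 0\<close> by (auto simp: J_def)
          show "\<iota> (u y) * y \<noteq> 0" if "y \<in> J" for y using that g by (auto simp: J_def)
          show "inj_on (\<lambda>y. v (\<iota> (u y) * y)) J"
          proof (rule inj_onI)
            fix y z assume yz: "y \<in> J" "z \<in> J" "v (\<iota> (u y) * y) = v (\<iota> (u z) * z)"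
            then obtain C D where "C \<in> F" "D \<in> F" "y = g C" "z = g D" by (auto simp: J_def)
            moreover have "?H #>\<^bsub>?G\<^esub> v y = ?H #>\<^bsub>?G\<^esub> v z"
              using yz g calculation by (intro same_coset[of y z "u y" "u z"]) (auto simp: J_def)
            ultimately show "y = z" using g by metis
          qed
        qed
        moreover have "(\<Sum>y\<in>J. \<iota> (u y) * y) = (\<Sum>y\<in>g ` F. \<iota> (u y) * y)"
          unfolding J_def using F by (intro sum.mono_neutral_left) auto
        ultimately show False using sum by simp
      qed
    qed
    hence "card (g ` F) \<le> V.dim UNIV" by (intro V.independent_card_le_dim) auto
    thus ?thesis by (simp add: card_image[OF inj])
  qed
  thus ?thesis using finite_if_finite_subsets_card_bdd by blast
qed

text \<open>
  Finiteness matters here: the cardinality of an infinite set of cosets would be \<open>0\<close>.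
\<close>

lemma ramification_index_pos: "ramification_index \<iota> v > 0"
proof -
  interpret G: comm_group "value_group v" by (rule comm_group_value_group)
  have "rcosets\<^bsub>value_group v\<^esub> (carrier (value_group (padic_abs :: 'p padic \<Rightarrow> real))) \<noteq> {}"
    by (auto simp: RCOSETS_def value_group_def intro!: exI[of _ 1])
  thus ?thesis using finite_value_cosets by (simp add: ramification_index_def card_gt_0_iff)
qed

text \<open>
  Lagrange's theorem in the group of value cosets, which has order \<open>e\<close>.
\<close>

lemma v_power_ramification_index:
  assumes "x \<noteq> 0"
  shows "\<exists>a\<noteq>0. v x ^ ramification_index \<iota> v = padic_abs (a :: 'p padic)"
proof -
  define G where "G = value_group v"
  define H where "H = carrier (value_group (padic_abs :: 'p padic \<Rightarrow> real))"
  define n where "n = ramification_index \<iota> v"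
  interpret G: comm_group G unfolding G_def by (rule comm_group_value_group)
  have sub: "subgroup H G" unfolding G_def H_def by (rule value_subgroup)
  interpret N: normal H G by (rule G.subgroup_imp_normal[OF sub])
  interpret Q: group "G Mod H" by (rule N.factorgroup_is_group)
  have vx: "v x \<in> carrier G" using assms by (simp add: G_def value_group_def)
  have coset: "H #>\<^bsub>G\<^esub> v x \<in> carrier (G Mod H)" using vx by (auto simp: carrier_FactGroup)
  have pow: "(H #>\<^bsub>G\<^esub> v x) [^]\<^bsub>G Mod H\<^esub> k = H #>\<^bsub>G\<^esub> (v x [^]\<^bsub>G\<^esub> k)" for k :: nat
  proof (induction k)
    case 0
    show ?case using N.subset by (simp add: G.coset_mult_one)
  next
    case (Suc k)
    thus ?case using vx by (simp add: N.rcos_sum)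
  qed
  have "Coset.order (G Mod H) = n"
    by (simp add: Coset.order_def n_def ramification_index_def G_def H_def FactGroup_def)
  hence "(H #>\<^bsub>G\<^esub> v x) [^]\<^bsub>G Mod H\<^esub> n = H" using Q.pow_order_eq_1[OF coset] by simp
  hence "H #>\<^bsub>G\<^esub> (v x [^]\<^bsub>G\<^esub> n) = H" by (simp only: pow)
  hence "v x [^]\<^bsub>G\<^esub> n \<in> H" by (rule G.coset_join1[OF _ G.nat_pow_closed[OF vx] sub])
  moreover have "v x [^]\<^bsub>G\<^esub> k = v x ^ k" for k :: nat
    by (induction k) (auto simp: G_def value_group_def nat_pow_def mult.commute)
  ultimately show ?thesis by (auto simp: H_def n_def value_group_def)
qed

lemma low_ramification:
  "low_ramification v CARD('p) (ramification_index \<iota> v)"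
proof
  show "prime CARD('p)" by (rule prime_card)
  have p1: "real CARD('p) > 1" using prime_gt_1_nat[OF prime_card[where 'a='p]] by simp
  show "v (of_nat CARD('p)) < 1" "0 < v (of_nat CARD('p))" using p1 by (simp_all add: v_CARD)
  show "ramification_index \<iota> v > 0" by (rule ramification_index_pos)
  fix x assume x: "v x < 1"
  show "v x ^ ramification_index \<iota> v \<le> v (of_nat CARD('p))"
  proof (cases "x = 0")
    case True
    thus ?thesis using ramification_index_pos by (simp add: v_CARD zero_power)
  next
    case False
    obtain a :: "'p padic" where a: "a \<noteq> 0" "v x ^ ramification_index \<iota> v = padic_abs a"
      using v_power_ramification_index[OF False] by blast
    obtain n where n: "padic_abs a = real CARD('p) powi n"
      using padic_abs_value[OF nonarchimedean_padic_abs a(1)] by blast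
    have "v x ^ ramification_index \<iota> v < 1"
      using x ramification_index_pos by (simp add: power_less_one_iff)
    hence "\<not> 0 \<le> n" using p1 one_le_power_int[of "real CARD('p)" n] unfolding a(2) n by linarith
    hence "n \<le> -1" by simp
    hence "real CARD('p) powi n \<le> real CARD('p) powi (-1)" using p1 by (intro power_int_increasing) auto
    thus ?thesis using a(2) n by (simp add: v_CARD power_int_minus divide_inverse)
  qed
qed

end

section \<open>The residue field\<close>

lemma (in ring) card_eq_power_dimension:
  assumes K: "subfield K R" "finite K" and dim: "dimension n K E"
  shows "finite E" "card E = card K ^ n"
proof -
  obtain Vs where Vs: "set Vs \<subseteq> carrier R" "independent K Vs" "length Vs = n" "Span K Vs = E"
    using exists_base[OF K(1) dim] by blast
  define L where "L = {Ks. set Ks \<subseteq> K \<and> length Ks = n}"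
  have "inj_on (\<lambda>Ks. combine Ks Vs) L"
  proof (rule inj_onI)
    fix Ks Ks' assume Ks: "Ks \<in> L" "Ks' \<in> L" "combine Ks Vs = combine Ks' Vs"
    have "combine Ks Vs \<in> Span K Vs"
      using Ks(1) unfolding Span_eq_combine_set_length_version[OF K(1) Vs(1)] L_def Vs(3) by blast
    from unique_decomposition[OF K(1) Vs(2) this] Ks show "Ks = Ks'"
      unfolding L_def Vs(3) by blast
  qed
  moreover have "(\<lambda>Ks. combine Ks Vs) ` L = E"
    unfolding Vs(4)[symmetric] Span_eq_combine_set_length_version[OF K(1) Vs(1)] L_def Vs(3) by blast
  moreover have "finite L" "card L = card K ^ n"
    unfolding L_def using K(2) by (auto simp: finite_lists_length_eq card_lists_length_eq)
  ultimately show "finite E" "card E = card K ^ n" by (auto simp: card_image)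
qed

context nonarchimedean
begin

definition residue_class :: "'k \<Rightarrow> 'k set" where
  "residue_class x = {y. v (y - x) < 1}"

lemma residue_class_eq_iff: "residue_class x = residue_class y \<longleftrightarrow> v (x - y) < 1"
proof
  assume "residue_class x = residue_class y"
  moreover have "x \<in> residue_class x" by (simp add: residue_class_def)
  ultimately show "v (x - y) < 1" by (auto simp: residue_class_def)
next
  assume xy: "v (x - y) < 1"
  have "v (z - x) < 1 \<longleftrightarrow> v (z - y) < 1" for z
    using v_add_less[of "z - x" 1 "x - y"] v_diff_less[of "z - y" 1 "x - y"] xy by auto
  thus "residue_class x = residue_class y" by (simp add: residue_class_def)
qed

lemma coset_eq_residue_class: "{x. v x < 1} +>\<^bsub>valuation_ring v\<^esub> x = residue_class x"
proof -
  have "y \<in> {x. v x < 1} +>\<^bsub>valuation_ring v\<^esub> x \<longleftrightarrow> y \<in> residue_class x" for y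
    unfolding a_r_coset_def' residue_class_def valuation_ring_def
    by (auto intro!: exI[of _ "y - x"])
  thus ?thesis by blast
qed

lemma cring_valuation_ring: "cring (valuation_ring v)"
proof (rule cringI)
  show "abelian_group (valuation_ring v)"
  proof (rule abelian_groupI)
    fix x assume "x \<in> carrier (valuation_ring v)"
    thus "\<exists>y\<in>carrier (valuation_ring v). y \<oplus>\<^bsub>valuation_ring v\<^esub> x = \<zero>\<^bsub>valuation_ring v\<^esub>"
      by (intro bexI[of _ "- x"]) (auto simp: valuation_ring_def)
  qed (auto simp: valuation_ring_def intro: v_add_le)
  show "Group.comm_monoid (valuation_ring v)"
    by (rule comm_monoidI) (auto simp: valuation_ring_def intro: v_mult_le_1)
qed (auto simp: valuation_ring_def algebra_simps)

lemma ideal_maximal: "ideal {x. v x < 1} (valuation_ring v)"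
proof -
  interpret R: cring "valuation_ring v" by (rule cring_valuation_ring)
  show ?thesis
  proof (rule idealI[OF R.ring_axioms])
    show "subgroup {x. v x < 1} (add_monoid (valuation_ring v))"
    proof (rule R.add.subgroupI)
      fix x assume x: "x \<in> {x. v x < 1}"
      have "\<ominus>\<^bsub>valuation_ring v\<^esub> x = - x"
        by (rule R.minus_equality) (use x in \<open>auto simp: valuation_ring_def\<close>)
      thus "\<ominus>\<^bsub>valuation_ring v\<^esub> x \<in> {x. v x < 1}" using x by simp
    qed (auto simp: valuation_ring_def intro: v_add_less exI[of _ 0])
    fix a x assume ax: "a \<in> {x. v x < 1}" "x \<in> carrier (valuation_ring v)"
    have "v x * v a \<le> 1 * v a" using ax by (intro mult_right_mono) (auto simp: valuation_ring_def)
    hence "v (x * a) < 1" using ax by (simp add: v_mult)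
    thus "x \<otimes>\<^bsub>valuation_ring v\<^esub> a \<in> {x. v x < 1}" "a \<otimes>\<^bsub>valuation_ring v\<^esub> x \<in> {x. v x < 1}"
      by (simp_all add: valuation_ring_def mult.commute)
  qed
qed

lemma carrier_residue_field: "carrier (residue_field v) = residue_class ` {x. v x \<le> 1}"
  unfolding residue_field_def FactRing_simps coset_eq_residue_class by (auto simp: valuation_ring_def)

lemma residue_field_one: "\<one>\<^bsub>residue_field v\<^esub> = residue_class 1"
  unfolding residue_field_def FactRing_simps coset_eq_residue_class by (simp add: valuation_ring_def)

lemma residue_field_zero: "\<zero>\<^bsub>residue_field v\<^esub> = residue_class 0"
  by (simp add: residue_field_def FactRing_def residue_class_def)

lemma residue_field_mult:
  assumes "v x \<le> 1" "v y \<le> 1"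
  shows "residue_class x \<otimes>\<^bsub>residue_field v\<^esub> residue_class y = residue_class (x * y)"
  using ideal.rcoset_mult_add[OF ideal_maximal, of x y] assms
  by (simp add: residue_field_def FactRing_def coset_eq_residue_class) (simp add: valuation_ring_def)

lemma residue_field_add:
  assumes "v x \<le> 1" "v y \<le> 1"
  shows "residue_class x \<oplus>\<^bsub>residue_field v\<^esub> residue_class y = residue_class (x + y)"
proof -
  interpret I: ideal "{x. v x < 1}" "valuation_ring v" by (rule ideal_maximal)
  show ?thesis using I.a_rcos_sum[of x y] assms
    by (simp add: residue_field_def FactRing_def coset_eq_residue_class) (simp add: valuation_ring_def)
qed

lemma nonzero_residues:
  "carrier (residue_field v) - {\<zero>\<^bsub>residue_field v\<^esub>} = residue_class ` {x. v x = 1}"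
proof -
  have "{x. v x = 1} = {x. v x \<le> 1 \<and> residue_class x \<noteq> residue_class 0}"
    by (auto simp: residue_class_eq_iff)
  thus ?thesis unfolding carrier_residue_field residue_field_zero by blast
qed

lemma field_residue_field: "field (residue_field v)"
proof -
  interpret F: cring "residue_field v"
    unfolding residue_field_def by (rule ideal.quotient_is_cring[OF ideal_maximal cring_valuation_ring])
  show ?thesis
  proof (rule F.cring_fieldI2)
    show "\<zero>\<^bsub>residue_field v\<^esub> \<noteq> \<one>\<^bsub>residue_field v\<^esub>"
      by (simp add: residue_field_zero residue_field_one residue_class_eq_iff)
    fix a assume a: "a \<in> carrier (residue_field v)" "a \<noteq> \<zero>\<^bsub>residue_field v\<^esub>"
    then obtain x where x: "a = residue_class x" "v x = 1"
      using nonzero_residues by blast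
    hence "x \<noteq> 0" by auto
    thus "\<exists>b\<in>carrier (residue_field v). a \<otimes>\<^bsub>residue_field v\<^esub> b = \<one>\<^bsub>residue_field v\<^esub>"
      using x by (intro bexI[of _ "residue_class (inverse x)"])
        (auto simp: residue_field_mult residue_field_one v_inverse carrier_residue_field)
  qed
qed

lemma residue_field_pow:
  assumes "v x \<le> 1"
  shows "residue_class x [^]\<^bsub>residue_field v\<^esub> (n :: nat) = residue_class (x ^ n)"
proof (induction n)
  case 0
  show ?case by (simp add: residue_field_one)
next
  case (Suc n)
  have "v (x ^ n) \<le> 1" using assms by (simp add: v_power power_le_one)
  thus ?case using Suc assms by (simp add: residue_field_mult mult.commute)
qed

lemma separated_units_le:
  assumes fin: "finite (carrier (residue_field v))"
    and T: "\<And>x. x \<in> T \<Longrightarrow> v x = 1" "\<And>x y. x \<in> T \<Longrightarrow> y \<in> T \<Longrightarrow> x \<noteq> y \<Longrightarrow> v (x - y) \<ge> 1"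
  shows "card T \<le> card (carrier (residue_field v)) - 1"
proof -
  interpret F: field "residue_field v" by (rule field_residue_field)
  have "inj_on residue_class T"
    using T(2) by (intro inj_onI) (meson not_le residue_class_eq_iff)
  moreover have "residue_class ` T \<subseteq> carrier (residue_field v) - {\<zero>\<^bsub>residue_field v\<^esub>}"
    unfolding nonzero_residues using T(1) by blast
  ultimately have "card T \<le> card (carrier (residue_field v) - {\<zero>\<^bsub>residue_field v\<^esub>})"
    using fin by (intro card_inj_on_le) auto
  thus ?thesis using fin by (simp add: card_Diff_singleton)
qed

text \<open>
  Representatives of the non-zero residue classes; Fermat's congruence is Lagrange's theorem in the
  multiplicative group of the residue field.
\<close>

lemma separated_units_exist:
  assumes fin: "finite (carrier (residue_field v))"
  defines "q \<equiv> card (carrier (residue_field v))"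
  shows "\<exists>T. finite T \<and> card T = q - 1 \<and> (\<forall>x\<in>T. v x = 1 \<and> v (x ^ (q - 1) - 1) < 1) \<and>
      (\<forall>x\<in>T. \<forall>y\<in>T. x \<noteq> y \<longrightarrow> v (x - y) \<ge> 1)"
proof -
  interpret F: field "residue_field v" by (rule field_residue_field)
  interpret M: group "mult_of (residue_field v)" by (rule F.field_mult_group)
  define N where "N = carrier (residue_field v) - {\<zero>\<^bsub>residue_field v\<^esub>}"
  have "\<exists>x. v x = 1 \<and> C = residue_class x" if "C \<in> N" for C
    using that unfolding N_def nonzero_residues by blast
  then obtain g where g: "\<And>C. C \<in> N \<Longrightarrow> v (g C) = 1 \<and> C = residue_class (g C)" by metis
  have inj: "inj_on g N" using g by (metis inj_onI)
  have card: "card N = q - 1" using fin by (simp add: N_def q_def card_Diff_singleton)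
  have pow: "v (g C ^ (q - 1) - 1) < 1" if C: "C \<in> N" for C
  proof -
    have "Coset.order (mult_of (residue_field v)) = q - 1"
      using card by (simp add: Coset.order_def N_def)
    hence "C [^]\<^bsub>residue_field v\<^esub> (q - 1) = \<one>\<^bsub>residue_field v\<^esub>"
      using M.pow_order_eq_1[of C] C by (simp add: N_def nat_pow_mult_of)
    hence "residue_class (g C ^ (q - 1)) = residue_class 1"
      using g[OF C] residue_field_pow[of "g C" "q - 1"] by (simp add: residue_field_one)
    thus ?thesis by (simp only: residue_class_eq_iff)
  qed
  have "v (g C - g D) \<ge> 1" if "C \<in> N" "D \<in> N" "g C \<noteq> g D" for C D
    using g that residue_class_eq_iff[of "g C" "g D"] by (metis not_le)
  thus ?thesis using fin inj card g pow
    by (intro exI[of _ "g ` N"]) (auto simp: N_def card_image)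
qed

end

context padic_extension
begin

lemma residue_subfield_eq:
  "residue_subfield \<iota> v = (\<lambda>a. residue_class (\<iota> a)) ` {a. padic_abs a \<le> 1}"
  unfolding residue_subfield_def coset_eq_residue_class by (simp add: valuation_ring_def)

lemma card_residue_subfield: "finite (residue_subfield \<iota> v)" "card (residue_subfield \<iota> v) = CARD('p)"
proof -
  interpret L: low_ramification v "CARD('p)" "ramification_index \<iota> v" by (rule low_ramification)
  have eq: "residue_subfield \<iota> v = (\<lambda>n. residue_class (of_nat n)) ` {..<CARD('p)}"
  proof
    show "residue_subfield \<iota> v \<subseteq> (\<lambda>n. residue_class (of_nat n)) ` {..<CARD('p)}"
    proof
      fix C assume "C \<in> residue_subfield \<iota> v"
      then obtain a where a: "C = residue_class (\<iota> a)" "padic_abs a \<le> 1" by (auto simp: residue_subfield_eq)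
      obtain n where n: "n < CARD('p)" "padic_abs (a - of_nat n) < 1"
        using padic_integer_residue[OF nonarchimedean_padic_abs a(2)] by blast
      have "v (\<iota> (a - of_nat n)) < 1" using n(2) by (simp only: v_emb)
      hence "v (\<iota> a - of_nat n) < 1" by (simp only: emb.hom_minus emb.hom_of_nat)
      hence "C = residue_class (of_nat n)" by (simp add: a(1) residue_class_eq_iff)
      thus "C \<in> (\<lambda>n. residue_class (of_nat n)) ` {..<CARD('p)}" using n(1) by blast
    qed
    show "(\<lambda>n. residue_class (of_nat n)) ` {..<CARD('p)} \<subseteq> residue_subfield \<iota> v"
    proof
      fix C assume "C \<in> (\<lambda>n. residue_class (of_nat n)) ` {..<CARD('p)}"
      then obtain n where "C = residue_class (of_nat n)" by blast
      hence "C = residue_class (\<iota> (of_nat n))" by (simp only: emb.hom_of_nat)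
      moreover have "padic_abs (of_nat n :: 'p padic) \<le> 1" by (rule P.v_of_nat_le)
      ultimately show "C \<in> residue_subfield \<iota> v" unfolding residue_subfield_eq by blast
    qed
  qed
  have aux: "residue_class (of_nat m) \<noteq> residue_class (of_nat n)" if "m < n" "n < CARD('p)" for m n
  proof -
    have "\<not> CARD('p) dvd n - m" using that by (simp add: nat_dvd_not_less)
    hence "v (of_nat (n - m)) = 1" by (rule L.v_of_nat_coprime)
    thus ?thesis using that by (simp add: residue_class_eq_iff of_nat_diff v_minus_commute)
  qed
  have "inj_on (\<lambda>n. residue_class (of_nat n)) {..<CARD('p)}"
    by (rule inj_onI) (metis aux lessThan_iff linorder_neqE_nat)
  thus "finite (residue_subfield \<iota> v)" "card (residue_subfield \<iota> v) = CARD('p)"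
    unfolding eq by (simp_all add: card_image)
qed

lemma subfield_residue_subfield: "subfield (residue_subfield \<iota> v) (residue_field v)"
proof -
  interpret F: field "residue_field v" by (rule field_residue_field)
  have le: "v (\<iota> a) \<le> 1" if "padic_abs a \<le> 1" for a using that by (simp add: v_emb)
  have mem: "residue_class (\<iota> a) \<in> residue_subfield \<iota> v" if "padic_abs a \<le> 1" for a
    using that by (auto simp: residue_subfield_eq)
  have carr: "residue_subfield \<iota> v \<subseteq> carrier (residue_field v)"
    using le by (auto simp: residue_subfield_eq carrier_residue_field)
  show ?thesis
  proof (rule F.subfieldI'[OF F.subringI[OF carr]])
    show "\<one>\<^bsub>residue_field v\<^esub> \<in> residue_subfield \<iota> v"
      using mem[of 1] by (simp add: residue_field_one)
  next
    fix C assume "C \<in> residue_subfield \<iota> v"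
    then obtain a where a: "C = residue_class (\<iota> a)" "padic_abs a \<le> 1" by (auto simp: residue_subfield_eq)
    have "\<ominus>\<^bsub>residue_field v\<^esub> C = residue_class (\<iota> (- a))"
    proof (rule F.minus_equality)
      show "residue_class (\<iota> (- a)) \<oplus>\<^bsub>residue_field v\<^esub> C = \<zero>\<^bsub>residue_field v\<^esub>"
        using a le by (simp add: residue_field_add residue_field_zero flip: emb.hom_add)
    qed (use carr mem a in auto)
    thus "\<ominus>\<^bsub>residue_field v\<^esub> C \<in> residue_subfield \<iota> v" using mem[of "- a"] a by simp
  next
    fix C D assume "C \<in> residue_subfield \<iota> v" "D \<in> residue_subfield \<iota> v"
    then obtain a b where ab: "C = residue_class (\<iota> a)" "padic_abs a \<le> 1"
        "D = residue_class (\<iota> b)" "padic_abs b \<le> 1" by (auto simp: residue_subfield_eq)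
    show "C \<otimes>\<^bsub>residue_field v\<^esub> D \<in> residue_subfield \<iota> v"
      using ab le mem[OF P.v_mult_le_1[OF ab(2,4)]] by (simp add: residue_field_mult emb.hom_mult)
    show "C \<oplus>\<^bsub>residue_field v\<^esub> D \<in> residue_subfield \<iota> v"
      using ab le mem[OF P.v_add_le[OF ab(2,4)]] by (simp add: residue_field_add emb.hom_add)
  next
    fix C assume C: "C \<in> residue_subfield \<iota> v - {\<zero>\<^bsub>residue_field v\<^esub>}"
    then obtain a where a: "C = residue_class (\<iota> a)" "padic_abs a \<le> 1" by (auto simp: residue_subfield_eq)
    have "\<not> padic_abs a < 1"
      using C unfolding a(1) residue_field_zero by (auto simp: residue_class_eq_iff v_emb)
    hence a1: "padic_abs a = 1" using a(2) by simp
    hence i1: "padic_abs (inverse a) = 1" and nz: "a \<noteq> 0" by (auto simp: P.v_inverse)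
    have "inv\<^bsub>residue_field v\<^esub> C = residue_class (\<iota> (inverse a))"
    proof (rule F.comm_inv_char)
      show "C \<otimes>\<^bsub>residue_field v\<^esub> residue_class (\<iota> (inverse a)) = \<one>\<^bsub>residue_field v\<^esub>"
        using a le i1 nz by (simp add: residue_field_mult residue_field_one flip: emb.hom_mult)
    qed (use carr mem a i1 in auto)
    thus "inv\<^bsub>residue_field v\<^esub> C \<in> residue_subfield \<iota> v" using mem[of "inverse a"] i1 by simp
  qed
qed

lemma card_residue_field:
  assumes "has_residue_degree \<iota> v f"
  shows "finite (carrier (residue_field v))" "card (carrier (residue_field v)) = CARD('p) ^ f"
proof -
  interpret F: field "residue_field v" by (rule field_residue_field)
  note card = F.card_eq_power_dimension[OF subfield_residue_subfield card_residue_subfield(1)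
      assms[unfolded has_residue_degree_def]]
  show "finite (carrier (residue_field v))" by (rule card(1))
  show "card (carrier (residue_field v)) = CARD('p) ^ f" using card(2) by (simp only: card_residue_subfield(2))
qed

lemma local_field:
  assumes f: "has_residue_degree \<iota> v f"
  shows "local_field v CARD('p) (ramification_index \<iota> v) (CARD('p) ^ f)"
proof -
  interpret L: low_ramification v "CARD('p)" "ramification_index \<iota> v" by (rule low_ramification)
  interpret F: field "residue_field v" by (rule field_residue_field)
  note fin = card_residue_field(1)[OF f] and card = card_residue_field(2)[OF f]
  have "card {\<zero>\<^bsub>residue_field v\<^esub>, \<one>\<^bsub>residue_field v\<^esub>} \<le> card (carrier (residue_field v))"
    using fin by (intro card_mono) auto
  hence two: "CARD('p) ^ f \<ge> 2" by (simp add: card)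
  hence "f > 0" by (cases f) auto
  show ?thesis
  proof
    show "CARD('p) ^ f \<ge> 2" by (rule two)
    show "v (of_nat (CARD('p) ^ f)) < 1"
      using L.v_p_less_1 \<open>f > 0\<close> by (simp add: v_power power_less_one_iff)
    show "card T \<le> CARD('p) ^ f - 1"
      if "\<And>x. x \<in> T \<Longrightarrow> v x = 1" "\<And>x y. x \<in> T \<Longrightarrow> y \<in> T \<Longrightarrow> x \<noteq> y \<Longrightarrow> 1 \<le> v (x - y)" for T
      using separated_units_le[OF fin] that by (simp add: card)
    show "\<exists>T. finite T \<and> card T = CARD('p) ^ f - 1 \<and>
        (\<forall>x\<in>T. v x = 1 \<and> v (x ^ (CARD('p) ^ f - 1) - 1) < 1) \<and>
        (\<forall>x\<in>T. \<forall>y\<in>T. x \<noteq> y \<longrightarrow> v (x - y) \<ge> 1)"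
      using separated_units_exist[OF fin] by (simp only: card)
    show "v_complete v" by (rule v_complete_extension)
  qed
qed

end

section \<open>The number of roots of trinomials over a finite extension\<close>

theorem mainTheorem4:
  fixes p e f :: nat and \<iota> :: "'p::prime_card padic \<Rightarrow> 'k::field"
  assumes "p = CARD('p)"
    and "finite_padic_extension \<iota>"
    and "has_ramification_and_residue_degree \<iota> e f"
    and "p > 2 + e"
  shows "B_m 2 TYPE('k) = enat (3 * (p ^ f - 1))"
proof -
  obtain v where v: "extends_padic_abs \<iota> v" "ramification_index \<iota> v = e" "has_residue_degree \<iota> v f"
    using assms(3) by (auto simp: has_ramification_and_residue_degree_def)
  interpret padic_extension \<iota> v using assms(2) v(1) by unfold_locales
  interpret local_field v p e "p ^ f"
    using local_field[OF v(3)] by (simp only: assms(1) v(2))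
  show ?thesis using assms(4) by (rule B_m_2_eq)
qed

end
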